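(* Let $G$ and $F$ be connected graphs with no loops and no parallel edges such that $E(G)=E(F)=E$, $M_t(G)=M_t(F)$, and $M(G)\neq M(F)$. Let $X\subseteq E$ be such that $R=G[X]$ is a quasi-Hamiltonian cycle in $G$ and $F[X]$ is a spanning tree in $F$. Suppose that $G$ has exactly three spokes $s_1$, $s_2$ and $s$, whose end-vertices in $R$ are $r_1$, $r_2$ and $r$ respectively, and that these belong to a 3-vertex path $r_1x_1rx_2r_2$ in $R$ (with edges $x_1,x_2$ and middle vertex $r$, so that $s$ is incident to $r$). Then: (c1) the graphs $G$ and $F$ are isomorphic; (c2) $F$ can be obtained from $G$ (up to the names of vertices) by a series of Whitney 2-vertex cut switches and, possibly, also by exchanging the two edges $x_i$ and $s_i$ for some $i\in\{1,2\}$; and (c3) the graphs $G$ and $F$ are 2-connected.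
   Context: Graphs are finite; each edge has two distinct end-vertices. The cycle matroid $M(G)$ is the matroid on $E(G)$ whose bases are the edge sets of maximal forests of $G$. The truncation $M_t$ of a matroid $M$ with set of bases $\mathcal{B}(M)$ is the matroid on the same ground set with set of bases $\{B\setminus\{x\}: B\in\mathcal{B}(M),\ x\in B\}$; put $M_t(G)=(M(G))_t$. Equality of matroids is equality on the labelled ground set. For $X\subseteq E(G)$, $G[X]$ is the subgraph with edge set $X$ whose vertices are those incident to at least one edge in $X$. A cycle $Q$ of $G$ is quasi-Hamiltonian if $V(Q)=V(G)\setminus\{q\}$ for some $q\in V(G)$. With $R=G[X]$ a quasi-Hamiltonian cycle, let $c$ be the unique vertex of $G$ not in $R$; a spoke of $G$ is an edge of $G$ incident to $c$. A Whitney 2-vertex cut switch (Whitney twist): if $G$ is the union of two edge-disjoint subgraphs $A$ and $B$ sharing exactly two vertices $u,v$, then every edge of $A$ incident to $u$ is made incident to $v$ instead, and vice versa. Exchanging two edges $e,f$ means interchanging their labels, i.e. interchanging the end-vertex pairs $\phi(e)$ and $\phi(f)$ of the incidence function $\phi$.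
   Formalization: Part (c2) is claimed only when G does not have exactly four vertices; for G = K4 it fails, e.g. when F is K4 labelled so that the triangle X of G becomes a star in F. *)

theory Defs
  imports Main "HOL-Combinatorics.Transposition"
begin

section \<open>Finite multigraphs with labelled edges\<close>

text \<open>Only the values of \<open>ends\<close> on \<open>edges\<close> are meaningful.\<close>

record ('v, 'e) mgraph =
  verts :: "'v set"
  edges :: "'e set"
  ends  :: "'e \<Rightarrow> 'v set"

text \<open>Every edge has two distinct end-vertices, so loops are excluded throughout; parallel
  edges are allowed.\<close>

definition graph :: "('v, 'e) mgraph \<Rightarrow> bool" where
  "graph G \<longleftrightarrow> finite (verts G) \<and> finite (edges G) \<and>
     (\<forall>e\<in>edges G. ends G e \<subseteq> verts G \<and> card (ends G e) = 2)"

definition no_parallel_edges :: "('v, 'e) mgraph \<Rightarrow> bool" where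
  "no_parallel_edges G \<longleftrightarrow> inj_on (ends G) (edges G)"

definition subgraph :: "('v, 'e) mgraph \<Rightarrow> ('v, 'e) mgraph \<Rightarrow> bool" where
  "subgraph H G \<longleftrightarrow> graph H \<and> verts H \<subseteq> verts G \<and> edges H \<subseteq> edges G \<and>
     (\<forall>e\<in>edges H. ends H e = ends G e)"

definition edge_induced :: "('v, 'e) mgraph \<Rightarrow> 'e set \<Rightarrow> ('v, 'e) mgraph" where
  "edge_induced G X = \<lparr>verts = (\<Union>e\<in>X. ends G e), edges = X, ends = ends G\<rparr>"

definition delete_vertex :: "('v, 'e) mgraph \<Rightarrow> 'v \<Rightarrow> ('v, 'e) mgraph" where
  "delete_vertex G v =
     \<lparr>verts = verts G - {v}, edges = {e \<in> edges G. v \<notin> ends G e}, ends = ends G\<rparr>"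

definition adjacent :: "('v, 'e) mgraph \<Rightarrow> 'v \<Rightarrow> 'v \<Rightarrow> bool" where
  "adjacent G u v \<longleftrightarrow> (\<exists>e\<in>edges G. ends G e = {u, v})"

definition graph_connected :: "('v, 'e) mgraph \<Rightarrow> bool" where
  "graph_connected G \<longleftrightarrow>
     verts G \<noteq> {} \<and> (\<forall>u\<in>verts G. \<forall>v\<in>verts G. (adjacent G)\<^sup>*\<^sup>* u v)"

definition two_connected :: "('v, 'e) mgraph \<Rightarrow> bool" where
  "two_connected G \<longleftrightarrow> 3 \<le> card (verts G) \<and> graph_connected G \<and>
     (\<forall>v\<in>verts G. graph_connected (delete_vertex G v))"

text \<open>The whole graph is a cycle \<open>v\<^sub>0 e\<^sub>0 v\<^sub>1 e\<^sub>1 \<dots> v\<^sub>0\<close>; in a multigraph this includes cycles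
  formed by two parallel edges.\<close>

definition is_cycle :: "('v, 'e) mgraph \<Rightarrow> bool" where
  "is_cycle Q \<longleftrightarrow> (\<exists>vs es. vs \<noteq> [] \<and> distinct vs \<and> distinct es \<and> length es = length vs \<and>
     set vs = verts Q \<and> set es = edges Q \<and>
     (\<forall>i<length vs. ends Q (es ! i) = {vs ! i, vs ! (Suc i mod length vs)}))"

definition is_forest :: "('v, 'e) mgraph \<Rightarrow> bool" where
  "is_forest G \<longleftrightarrow> \<not> (\<exists>Q. subgraph Q G \<and> is_cycle Q)"

definition is_tree :: "('v, 'e) mgraph \<Rightarrow> bool" where
  "is_tree T \<longleftrightarrow> graph_connected T \<and> is_forest T"

definition spanning_tree :: "('v, 'e) mgraph \<Rightarrow> ('v, 'e) mgraph \<Rightarrow> bool" where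
  "spanning_tree G T \<longleftrightarrow> subgraph T G \<and> is_tree T \<and> verts T = verts G"

definition quasi_hamiltonian_cycle :: "('v, 'e) mgraph \<Rightarrow> ('v, 'e) mgraph \<Rightarrow> bool" where
  "quasi_hamiltonian_cycle G Q \<longleftrightarrow>
     subgraph Q G \<and> is_cycle Q \<and> (\<exists>q\<in>verts G. verts Q = verts G - {q})"

definition spokes :: "('v, 'e) mgraph \<Rightarrow> 'v \<Rightarrow> 'e set" where
  "spokes G c = {e \<in> edges G. c \<in> ends G e}"


section \<open>Matroids given by their bases\<close>

record 'e matroid =
  ground :: "'e set"
  bases  :: "'e set set"

definition cycle_matroid :: "('v, 'e) mgraph \<Rightarrow> 'e matroid" where
  "cycle_matroid G = \<lparr>ground = edges G,
     bases = {B. B \<subseteq> edges G \<and> is_forest (edge_induced G B) \<and>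
        (\<forall>B'. B \<subset> B' \<and> B' \<subseteq> edges G \<longrightarrow> \<not> is_forest (edge_induced G B'))}\<rparr>"

definition truncation :: "'e matroid \<Rightarrow> 'e matroid" where
  "truncation M = \<lparr>ground = ground M, bases = {B - {x} |B x. B \<in> bases M \<and> x \<in> B}\<rparr>"

definition truncated_cycle_matroid :: "('v, 'e) mgraph \<Rightarrow> 'e matroid" where
  "truncated_cycle_matroid G = truncation (cycle_matroid G)"


section \<open>Isomorphisms and operations on graphs\<close>

definition graph_isomorphic :: "('v, 'e) mgraph \<Rightarrow> ('w, 'f) mgraph \<Rightarrow> bool" where
  "graph_isomorphic G H \<longleftrightarrow> (\<exists>f g. bij_betw f (verts G) (verts H) \<and>
     bij_betw g (edges G) (edges H) \<and> (\<forall>e\<in>edges G. ends H (g e) = f ` ends G e))"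

text \<open>Isomorphism that fixes every edge label, i.e. equality up to the names of vertices.\<close>

definition equal_up_to_vertex_names :: "('v, 'e) mgraph \<Rightarrow> ('w, 'e) mgraph \<Rightarrow> bool" where
  "equal_up_to_vertex_names G H \<longleftrightarrow> edges G = edges H \<and>
     (\<exists>f. bij_betw f (verts G) (verts H) \<and> (\<forall>e\<in>edges G. ends H e = f ` ends G e))"

text \<open>The image of the end-vertex pair under the transposition of \<open>u\<close> and \<open>v\<close> realises the
  switch; an edge of \<open>A\<close> joining \<open>u\<close> and \<open>v\<close> is unaffected.\<close>

definition whitney_switch :: "('v, 'e) mgraph \<Rightarrow> ('v, 'e) mgraph \<Rightarrow> bool" where
  "whitney_switch G H \<longleftrightarrow> (\<exists>A B u v. subgraph A G \<and> subgraph B G \<and>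
     verts A \<union> verts B = verts G \<and> edges A \<union> edges B = edges G \<and>
     edges A \<inter> edges B = {} \<and> u \<noteq> v \<and> verts A \<inter> verts B = {u, v} \<and>
     H = G\<lparr>ends := (\<lambda>e. if e \<in> edges A then transpose u v ` ends G e else ends G e)\<rparr>)"

definition exchange_edges :: "'e \<Rightarrow> 'e \<Rightarrow> ('v, 'e) mgraph \<Rightarrow> ('v, 'e) mgraph" where
  "exchange_edges e f G = G\<lparr>ends := (ends G)(e := ends G f, f := ends G e)\<rparr>"

text \<open>\<open>H\<close> arises from \<open>G\<close> by a (possibly empty) series of Whitney switches, in which at most
  once, at an arbitrary position, one of the pairs of edges in \<open>S\<close> is exchanged.\<close>

definition switches_and_exchange ::
  "('e \<times> 'e) set \<Rightarrow> ('v, 'e) mgraph \<Rightarrow> ('v, 'e) mgraph \<Rightarrow> bool" where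
  "switches_and_exchange S G H \<longleftrightarrow> whitney_switch\<^sup>*\<^sup>* G H \<or>
     (\<exists>(e, f)\<in>S. \<exists>G'. whitney_switch\<^sup>*\<^sup>* G G' \<and> whitney_switch\<^sup>*\<^sup>* (exchange_edges e f G') H)"

end

theory Submission
  imports Defs "HOL-Library.Multiset"
begin

text \<open>Let \<open>n = |X|\<close>. Equality of the truncations means that \<open>G\<close> and \<open>F\<close> have the same forests
  with fewer than \<open>n\<close> edges. A chord of the cycle \<open>X\<close> would split it into two circuits with fewer
  than \<open>n\<close> edges, hence dependent in \<open>F\<close>, and \<open>X\<close> would be dependent in \<open>F\<close>. So \<open>G\<close> consists of \<open>X\<close>
  and the three spokes: it is \<open>K\<^sub>4\<close> with one edge replaced by the path \<open>X - {x\<^sub>1, x\<^sub>2}\<close>. For \<open>n = 3\<close>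
  both graphs are \<open>K\<^sub>4\<close>. For \<open>n \<ge> 4\<close> the triangles \<open>s\<^sub>1 x\<^sub>1 s\<close> and \<open>s\<^sub>2 x\<^sub>2 s\<close> survive in \<open>F\<close>, and the
  small forests force \<open>X \<union> {s}\<close> to be a Hamiltonian cycle of \<open>F\<close>. Then \<open>F\<close> is again a subdivided
  \<open>K\<^sub>4\<close> with \<open>x\<^sub>1\<close> and \<open>s\<^sub>1\<close> exchanged and the edges of the path permuted; a Whitney switch at two
  consecutive edges of the path transposes them. Forests and circuits are handled over \<open>GF(2)\<close>:
  a set is a forest iff it has no nonempty subset meeting every vertex in an even number of
  edges.\<close>

subsection \<open>Even edge sets\<close>

text \<open>The \<open>v\<close>-coordinate of the boundary of the chain \<open>C\<close> over
  \<open>GF(2)\<close>; \<open>even_set\<close> is thus membership in the cycle space and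
  \<open>acyclic_set\<close> linear independence of incidence vectors. The incidence function is a
  separate argument because the same edge set is examined in \<open>G\<close>, in \<open>F\<close>
  and in subgraphs.\<close>

definition odd_at :: "('e \<Rightarrow> 'v set) \<Rightarrow> 'e set \<Rightarrow> 'v \<Rightarrow> bool" where
  "odd_at \<phi> C v \<longleftrightarrow> odd (card {e \<in> C. v \<in> \<phi> e})"

definition even_set :: "('e \<Rightarrow> 'v set) \<Rightarrow> 'e set \<Rightarrow> bool" where
  "even_set \<phi> C \<longleftrightarrow> (\<forall>v. \<not> odd_at \<phi> C v)"

definition acyclic_set :: "('e \<Rightarrow> 'v set) \<Rightarrow> 'e set \<Rightarrow> bool" where
  "acyclic_set \<phi> I \<longleftrightarrow> (\<forall>C\<subseteq>I. even_set \<phi> C \<longrightarrow> C = {})"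

lemma odd_at_empty [simp]: "\<not> odd_at \<phi> {} v"
  by (simp add: odd_at_def)

text \<open>Linearity of the boundary: edges of \<open>A \<inter> B\<close> are counted twice and
  vanish modulo 2.\<close>

lemma odd_at_sym_diff:
  assumes "finite A" "finite B"
  shows "odd_at \<phi> (sym_diff A B) v \<longleftrightarrow> odd_at \<phi> A v \<noteq> odd_at \<phi> B v"
proof -
  let ?f = "\<lambda>C. {e \<in> C. v \<in> \<phi> e}"
  have 1: "card (?f A) = card (?f (A - B)) + card (?f (A \<inter> B))"
    using assms by (subst card_Un_disjoint [symmetric]) (auto intro!: arg_cong [of _ _ card])
  have 2: "card (?f B) = card (?f (B - A)) + card (?f (A \<inter> B))"
    using assms by (subst card_Un_disjoint [symmetric]) (auto intro!: arg_cong [of _ _ card])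
  have 3: "card (?f (sym_diff A B)) = card (?f (A - B)) + card (?f (B - A))"
    using assms by (subst card_Un_disjoint [symmetric]) (auto intro!: arg_cong [of _ _ card])
  show ?thesis
    unfolding odd_at_def 1 2 3 even_add by blast
qed

lemma odd_at_insert:
  assumes "finite C" "e \<notin> C"
  shows "odd_at \<phi> (insert e C) v \<longleftrightarrow> (v \<in> \<phi> e) \<noteq> odd_at \<phi> C v"
proof -
  have "{f \<in> insert e C. v \<in> \<phi> f} =
      (if v \<in> \<phi> e then insert e {f \<in> C. v \<in> \<phi> f} else {f \<in> C. v \<in> \<phi> f})"
    by auto
  then show ?thesis
    using assms by (simp add: odd_at_def)
qed

lemma odd_at_cong: "(\<And>e. e \<in> C \<Longrightarrow> \<phi> e = \<psi> e) \<Longrightarrow> odd_at \<phi> C v \<longleftrightarrow> odd_at \<psi> C v"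
  unfolding odd_at_def by (rule arg_cong[where f = "\<lambda>A. odd (card A)"]) auto

lemma even_set_cong: "(\<And>e. e \<in> C \<Longrightarrow> \<phi> e = \<psi> e) \<Longrightarrow> even_set \<phi> C \<longleftrightarrow> even_set \<psi> C"
  unfolding even_set_def by (simp add: odd_at_cong[of C \<phi> \<psi>])

lemma even_set_sym_diff:
  "\<lbrakk>finite A; finite B; even_set \<phi> A; even_set \<phi> B\<rbrakk> \<Longrightarrow> even_set \<phi> (sym_diff A B)"
  by (simp add: even_set_def odd_at_sym_diff)

text \<open>Closes a path to a circuit: the boundary of \<open>C\<close> is \<open>u + v\<close>,
  which \<open>e\<close> cancels.\<close>

lemma even_set_insertI:
  assumes "finite C" "e \<notin> C" "\<phi> e = {u, v}" "\<And>w. odd_at \<phi> C w \<longleftrightarrow> (w = u) \<noteq> (w = v)" "u \<noteq> v"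
  shows "even_set \<phi> (insert e C)"
  using assms by (auto simp: even_set_def odd_at_insert)

lemma acyclic_set_subset: "acyclic_set \<phi> I \<Longrightarrow> J \<subseteq> I \<Longrightarrow> acyclic_set \<phi> J"
  by (auto simp: acyclic_set_def)

text \<open>A single edge has odd degree at its ends, and two edges with even degrees everywhere are
  parallel. The bound later shows that a chord leaves at least two edges on either side and that
  triangles survive in \<open>F\<close>.\<close>

lemma even_set_card_ge_3:
  assumes "finite C" "even_set \<phi> C" "C \<noteq> {}" "\<forall>e\<in>C. card (\<phi> e) = 2" "inj_on \<phi> C"
  shows "3 \<le> card C"
proof (rule ccontr)
  assume "\<not> 3 \<le> card C"
  moreover have "card C \<noteq> 0"
    using assms(1,3) by simp
  ultimately consider "card C = 1" | "card C = 2"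
    by linarith
  then show False
  proof cases
    case 1
    then obtain e where e: "C = {e}" by (auto simp: card_1_singleton_iff)
    then obtain v where "v \<in> \<phi> e" using assms(4) by (cases "\<phi> e = {}") auto
    then show False
      using assms(2) e odd_at_insert[of "{}" e \<phi> v] by (simp add: even_set_def)
  next
    case 2
    then obtain e f where ef: "C = {e, f}" "e \<noteq> f" by (auto simp: card_2_iff)
    have "v \<in> \<phi> e \<longleftrightarrow> v \<in> \<phi> f" for v
      using assms(2) ef odd_at_insert[of "{f}" e \<phi> v] odd_at_insert[of "{}" f \<phi> v]
      by (simp add: even_set_def)
    then have "\<phi> e = \<phi> f" by blast
    then show False using assms(5) ef by (auto simp: inj_on_def)
  qed
qed

subsection \<open>Paths and cycles\<close>

definition upath :: "('e \<Rightarrow> 'v set) \<Rightarrow> 'v list \<Rightarrow> 'e list \<Rightarrow> bool" where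
  "upath \<phi> vs es \<longleftrightarrow> distinct vs \<and> length vs = Suc (length es) \<and>
     (\<forall>i<length es. \<phi> (es ! i) = {vs ! i, vs ! Suc i})"

lemma upath_Nil [simp]: "upath \<phi> vs [] \<longleftrightarrow> (\<exists>v. vs = [v])"
  by (auto simp: upath_def length_Suc_conv)

lemma upath_Cons:
  "upath \<phi> vs (e # es) \<longleftrightarrow>
    (\<exists>u ws. vs = u # ws \<and> u \<notin> set ws \<and> \<phi> e = {u, hd ws} \<and> upath \<phi> ws es)"
proof (cases vs)
  case Nil
  then show ?thesis by (simp add: upath_def)
next
  case (Cons u ws)
  have "\<phi> e = {u, ws ! 0} \<longleftrightarrow> \<phi> e = {u, hd ws}" if "length ws = Suc (length es)"
    using that by (cases ws) auto
  moreover have "(\<forall>i<Suc (length es). \<phi> ((e # es) ! i) = {(u # ws) ! i, ws ! i}) \<longleftrightarrow>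
      \<phi> e = {u, ws ! 0} \<and> (\<forall>i<length es. \<phi> (es ! i) = {ws ! i, ws ! Suc i})"
    by (auto simp: All_less_Suc2)
  ultimately show ?thesis
    by (auto simp: upath_def Cons)
qed

lemma upath_rev:
  assumes "upath \<phi> vs es"
  shows "upath \<phi> (rev vs) (rev es)"
proof -
  have "\<phi> (rev es ! i) = {rev vs ! i, rev vs ! Suc i}" if "i < length es" for i
  proof -
    have "\<phi> (es ! (length es - Suc i)) = {vs ! (length es - Suc i), vs ! Suc (length es - Suc i)}"
      using assms that by (simp add: upath_def)
    moreover have "Suc (length es - Suc i) = length es - i"
      using that by simp
    ultimately show ?thesis
      using assms that by (auto simp: upath_def rev_nth insert_commute)
  qed
  then show ?thesis
    using assms by (simp add: upath_def)
qed

lemma upath_take: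
  "upath \<phi> vs es \<Longrightarrow> j \<le> length es \<Longrightarrow> upath \<phi> (take (Suc j) vs) (take j es)"
  by (auto simp: upath_def)

lemma upath_edge_subset: "upath \<phi> vs es \<Longrightarrow> e \<in> set es \<Longrightarrow> \<phi> e \<subseteq> set vs"
  by (auto simp: upath_def in_set_conv_nth[of e] intro!: nth_mem)

lemma upath_neq_Nil: "upath \<phi> vs es \<Longrightarrow> vs \<noteq> []"
  by (auto simp: upath_def)

lemma upath_distinct_edges: "upath \<phi> vs es \<Longrightarrow> distinct es"
proof (induction es arbitrary: vs)
  case (Cons e es)
  then obtain u ws where u: "u \<notin> set ws" "\<phi> e = {u, hd ws}" "upath \<phi> ws es"
    by (auto simp: upath_Cons)
  then have "e \<notin> set es"
    using upath_edge_subset[OF u(3), of e] by auto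
  then show ?case
    using Cons.IH[OF u(3)] by simp
qed simp

text \<open>All later edges lie in the path without its first vertex. This identifies the end edge
  of a path from one of its ends.\<close>

lemma upath_hd_edge:
  assumes "upath \<phi> vs (e # es)" "f \<in> set (e # es)" "hd vs \<in> \<phi> f"
  shows "f = e"
proof (rule ccontr)
  assume "f \<noteq> e"
  obtain u ws where "vs = u # ws" "u \<notin> set ws" "upath \<phi> ws es"
    using assms(1) by (auto simp: upath_Cons)
  then show False
    using upath_edge_subset[of \<phi> ws es f] \<open>f \<noteq> e\<close> assms(2,3) by auto
qed

text \<open>Inner vertices cancel in the sum of the end pairs. The inequality of truth values is
  addition modulo 2, so a path without edges has no odd vertex.\<close>

lemma upath_odd_at:
  assumes "upath \<phi> vs es"
  shows "odd_at \<phi> (set es) w \<longleftrightarrow> (w = hd vs) \<noteq> (w = last vs)"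
  using assms
proof (induction es arbitrary: vs)
  case (Cons e es)
  then obtain u ws where u: "vs = u # ws" "u \<notin> set ws" "\<phi> e = {u, hd ws}" "upath \<phi> ws es"
    by (auto simp: upath_Cons)
  moreover have "e \<notin> set es"
    using upath_distinct_edges[OF Cons.prems] by simp
  moreover have "ws \<noteq> []" using u(4) by (rule upath_neq_Nil)
  moreover from this have "hd ws \<in> set ws" "last ws \<in> set ws" by simp_all
  ultimately show ?case
    using Cons.IH[OF u(4)] by (auto simp: odd_at_insert)
qed auto

text \<open>The first vertex has degree one, so no even subset uses the first edge; the rest is a
  shorter path.\<close>

lemma upath_acyclic:
  assumes "upath \<phi> vs es"
  shows "acyclic_set \<phi> (set es)"
  using assms
proof (induction es arbitrary: vs)
  case (Cons e es)
  then obtain u ws where u: "vs = u # ws" "u \<notin> set ws" "\<phi> e = {u, hd ws}" "upath \<phi> ws es"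
    by (auto simp: upath_Cons)
  show ?case
    unfolding acyclic_set_def
  proof (intro allI impI)
    fix C assume C: "C \<subseteq> set (e # es)" "even_set \<phi> C"
    have "e \<notin> C"
    proof
      assume "e \<in> C"
      then have "{f \<in> C. u \<in> \<phi> f} = {e}"
        using C(1) upath_hd_edge[OF Cons.prems] u by auto
      then have "odd_at \<phi> C u" by (simp add: odd_at_def)
      then show False using C(2) by (simp add: even_set_def)
    qed
    then show "C = {}"
      using C Cons.IH[OF u(4)] by (auto simp: acyclic_set_def)
  qed
qed (auto simp: acyclic_set_def)

text \<open>A longest path in a nonempty even set closes up at its first vertex.\<close>

lemma even_set_contains_cycle:
  assumes fin: "finite C" and ne: "C \<noteq> {}" and ev: "even_set \<phi> C"
    and two: "\<forall>e\<in>C. card (\<phi> e) = 2"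
  obtains vs es f where "upath \<phi> vs es" "set es \<subseteq> C" "f \<in> C" "f \<notin> set es"
    "\<phi> f = {hd vs, last vs}"
proof -
  let ?P = "\<lambda>(vs, es). upath \<phi> vs es \<and> set es \<subseteq> C \<and> es \<noteq> []"
  obtain e0 where e0: "e0 \<in> C" using ne by blast
  then obtain a b where ab: "\<phi> e0 = {a, b}" "a \<noteq> b" using two by (auto simp: card_2_iff)
  have "?P ([a, b], [e0])"
    using e0 ab by (auto simp: upath_Cons)
  moreover have "\<forall>p. ?P p \<longrightarrow> length (snd p) \<le> card C"
  proof clarsimp
    fix vs es assume "upath \<phi> vs es" "set es \<subseteq> C"
    then show "length es \<le> card C"
      using upath_distinct_edges distinct_card card_mono fin by metis
  qed
  \<comment> \<open>The bound is \<open>Suc (card C)\<close> because the rule asks for a strict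
    one.\<close>
  ultimately have "\<exists>p. ?P p \<and> (\<forall>q. ?P q \<longrightarrow> length (snd q) \<le> length (snd p))"
    using ex_has_greatest_nat[of ?P "([a, b], [e0])" "\<lambda>p. length (snd p)" "Suc (card C)"]
    by (simp add: less_Suc_eq_le)
  then obtain p where p: "?P p" and pmax: "\<And>q. ?P q \<Longrightarrow> length (snd q) \<le> length (snd p)"
    by blast
  obtain vs es where "p = (vs, es)" by (cases p)
  with p have path: "upath \<phi> vs es" and sub: "set es \<subseteq> C" and "es \<noteq> []" by auto
  then obtain e es' where es: "es = e # es'" by (cases es) auto
  obtain u ws where vs: "vs = u # ws" "u \<notin> set ws" "\<phi> e = {u, hd ws}" "upath \<phi> ws es'"
    using path es by (auto simp: upath_Cons)
  \<comment> \<open>The degree of \<open>u\<close> in \<open>C\<close> is even and positive, so a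
    second edge leaves \<open>u\<close>.\<close>
  have "\<exists>f\<in>C. f \<noteq> e \<and> u \<in> \<phi> f"
  proof (rule ccontr)
    assume "\<not> ?thesis"
    then have "{f \<in> C. u \<in> \<phi> f} = {e}" using sub es vs by auto
    then have "odd_at \<phi> C u" by (simp add: odd_at_def)
    then show False using ev by (simp add: even_set_def)
  qed
  then obtain f where f: "f \<in> C" "f \<noteq> e" "u \<in> \<phi> f" by blast
  then obtain w where w: "\<phi> f = {u, w}" "u \<noteq> w"
    using two by (fastforce simp: card_2_iff)
  \<comment> \<open>Otherwise prepending \<open>f\<close> would give a longer path.\<close>
  have "w \<in> set vs"
  proof (rule ccontr)
    assume "w \<notin> set vs"
    then have "?P (w # vs, f # es)"
      using path sub f w vs by (auto simp: upath_Cons)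
    then show False
      using pmax[of "(w # vs, f # es)"] \<open>p = (vs, es)\<close> by simp
  qed
  then obtain j where j: "j < length vs" "vs ! j = w" by (auto simp: in_set_conv_nth)
  have len: "length vs = Suc (length es)" using path by (simp add: upath_def)
  show ?thesis
  proof
    show "upath \<phi> (take (Suc j) vs) (take j es)"
      using upath_take[OF path, of j] j len by simp
    show "set (take j es) \<subseteq> C" using sub set_take_subset by fastforce
    have "f \<notin> set es"
      using upath_hd_edge[of \<phi> vs e es' f] path es f vs by auto
    then show "f \<notin> set (take j es)" using set_take_subset by fastforce
    show "\<phi> f = {hd (take (Suc j) vs), last (take (Suc j) vs)}"
    proof -
      have "last (take (Suc j) vs) = w"
        by (simp only: take_Suc_conv_app_nth[OF j(1)] j(2) last_snoc)
      moreover have "hd (take (Suc j) vs) = u"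
        using vs(1) by simp
      ultimately show ?thesis using w(1) by simp
    qed
  qed (use f in auto)
qed

lemma is_cycleI:
  assumes "upath \<phi> vs es" "f \<notin> set es" "\<phi> f = {hd vs, last vs}"
  shows "is_cycle \<lparr>verts = set vs, edges = insert f (set es), ends = \<phi>\<rparr>"
  unfolding is_cycle_def
proof (intro exI[of _ vs] exI[of _ "es @ [f]"] conjI allI impI)
  have len: "length vs = Suc (length es)" using assms(1) by (simp add: upath_def)
  show "vs \<noteq> []" using assms(1) by (rule upath_neq_Nil)
  show "distinct vs" using assms(1) by (simp add: upath_def)
  show "distinct (es @ [f])" using assms upath_distinct_edges by auto
  fix i assume "i < length vs"
  then consider "i < length es" | "i = length es" using len by linarith
  then show "ends \<lparr>verts = set vs, edges = insert f (set es), ends = \<phi>\<rparr> ((es @ [f]) ! i) =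
         {vs ! i, vs ! (Suc i mod length vs)}"
  proof cases
    case 1
    then show ?thesis using assms(1) len by (simp add: upath_def nth_append)
  next
    case 2
    then show ?thesis using assms(3) len \<open>vs \<noteq> []\<close>
      by (auto simp: hd_conv_nth last_conv_nth)
  qed
qed (use assms in \<open>auto simp: upath_def\<close>)

text \<open>Rotation by \<open>Suc k\<close> moves \<open>e\<close> to the last position, where it
  joins the last vertex to the first. Dropping it leaves a path, which is reversed if its ends come
  in the wrong order.\<close>

lemma is_cycle_remove_edge:
  assumes "is_cycle Q" "e \<in> edges Q" "ends Q e = {u, v}"
  obtains vs es where "upath (ends Q) vs es" "hd vs = u" "last vs = v" "set vs = verts Q"
    "set es = edges Q - {e}"
proof -
  obtain vs es where c: "vs \<noteq> []" "distinct vs" "distinct es" "length es = length vs"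
    "set vs = verts Q" "set es = edges Q"
    and nth: "\<forall>i<length vs. ends Q (es ! i) = {vs ! i, vs ! (Suc i mod length vs)}"
    using assms(1) unfolding is_cycle_def by blast
  obtain k where k: "k < length es" "es ! k = e"
    using assms(2) c by (metis in_set_conv_nth)
  define m where "m = length vs"
  define vs' es' where "vs' = rotate (Suc k) vs" and "es' = rotate (Suc k) es"
  have m: "length vs' = m" "length es' = m" "m > 0" "k < m"
    using c k by (auto simp: vs'_def es'_def m_def)
  have nth': "ends Q (es' ! i) = {vs' ! i, vs' ! (Suc i mod m)}" if "i < m" for i
  proof -
    have "(Suc k + i) mod m < m" using m by simp
    moreover have "es' ! i = es ! ((Suc k + i) mod m)"
      using that c unfolding es'_def m_def by (subst nth_rotate) auto
    moreover have "vs' ! i = vs ! ((Suc k + i) mod m)"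
      using that c unfolding vs'_def m_def by (subst nth_rotate) auto
    moreover have "vs' ! (Suc i mod m) = vs ! ((Suc k + Suc i mod m) mod m)"
      using m c unfolding vs'_def m_def by (subst nth_rotate) auto
    moreover have "(Suc k + Suc i mod m) mod m = Suc ((Suc k + i) mod m) mod m"
      by (metis add_Suc_right mod_Suc_eq mod_add_right_eq)
    ultimately show ?thesis using nth unfolding m_def by metis
  qed
  have last: "es' ! (m - 1) = e"
  proof -
    have "(Suc k + (m - 1)) mod m = k" using m by simp
    then show ?thesis using k m c unfolding es'_def m_def by (subst nth_rotate) auto
  qed
  have dist: "distinct vs'" "distinct es'" using c by (simp_all add: vs'_def es'_def)
  have set': "set vs' = verts Q" "set es' = edges Q" using c by (simp_all add: vs'_def es'_def)
  have ne: "es' \<noteq> []" "vs' \<noteq> []" using m by auto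
  have es': "es' = butlast es' @ [e]"
    using last ne m by (metis append_butlast_last_id last_conv_nth)
  have path: "upath (ends Q) vs' (butlast es')"
    using dist m nth' by (auto simp: upath_def nth_butlast)
  have bl: "set (butlast es') = edges Q - {e}"
  proof -
    have "distinct (butlast es' @ [e])" using dist es' by simp
    moreover have "set (butlast es' @ [e]) = edges Q" using set' es' by simp
    ultimately show ?thesis by auto
  qed
  have "{hd vs', last vs'} = {u, v}"
    using nth'[of "m - 1"] m last ne assms(3) by (simp add: hd_conv_nth last_conv_nth insert_commute)
  then consider "hd vs' = u" "last vs' = v" | "hd vs' = v" "last vs' = u"
    by (auto simp: doubleton_eq_iff)
  then show ?thesis
  proof cases
    case 1
    then show ?thesis using that path set' bl by blast
  next
    case 2
    then show ?thesis
      using that[OF upath_rev[OF path]] set' bl ne by (simp add: hd_rev last_rev)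
  qed
qed

section \<open>Cycles of graphs as even sets, forests as independent sets\<close>

lemma is_cycle_even_set:
  assumes "is_cycle Q" "graph Q"
  shows "even_set (ends Q) (edges Q)" "edges Q \<noteq> {}"
proof -
  show ne: "edges Q \<noteq> {}" using assms(1) by (auto simp: is_cycle_def)
  then obtain e where e: "e \<in> edges Q" by blast
  then obtain u v where uv: "ends Q e = {u, v}" "u \<noteq> v"
    using assms(2) by (fastforce simp: graph_def card_2_iff)
  obtain vs es where p: "upath (ends Q) vs es" "hd vs = u" "last vs = v" "set es = edges Q - {e}"
    using is_cycle_remove_edge[OF assms(1) e uv(1)] by metis
  have fin: "finite (edges Q)" using assms(2) by (simp add: graph_def)
  have "even_set (ends Q) (insert e (set es))"
    by (rule even_set_insertI[where u = u and v = v]) (use p uv fin upath_odd_at[OF p(1)] in auto)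
  then show "even_set (ends Q) (edges Q)" using p e by (simp add: insert_absorb)
qed

text \<open>A closed path inside an even subset is the required cycle. Being a subgraph of
  \<open>edge_induced G I\<close> also demands that all its vertices be ends of edges in
  \<open>I\<close>.\<close>

lemma dependent_set_not_forest:
  assumes "graph G" "I \<subseteq> edges G" "\<not> acyclic_set (ends G) I"
  shows "\<not> is_forest (edge_induced G I)"
proof -
  obtain C where C: "C \<subseteq> I" "even_set (ends G) C" "C \<noteq> {}"
    using assms(3) by (auto simp: acyclic_set_def)
  have fin: "finite I" using assms by (auto simp: graph_def intro: finite_subset)
  have two: "\<forall>e\<in>I. card (ends G e) = 2" using assms by (auto simp: graph_def)
  obtain vs es f where p: "upath (ends G) vs es" "set es \<subseteq> C" "f \<in> C" "f \<notin> set es"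
    "ends G f = {hd vs, last vs}"
  proof (rule even_set_contains_cycle[of C "ends G"])
    show "finite C" using C(1) fin by (rule finite_subset)
  qed (use C two in auto)
  let ?Q = "\<lparr>verts = set vs, edges = insert f (set es), ends = ends G\<rparr>"
  \<comment> \<open>A path without edges would make \<open>f\<close> a loop.\<close>
  have "es \<noteq> []"
  proof
    assume "es = []"
    with p have "card (ends G f) = 1" by (auto simp: upath_def length_Suc_conv)
    then show False using two C(1) p(3) by (metis numeral_eq_one_iff semiring_norm(85) subsetD)
  qed
  have vsub: "set vs \<subseteq> (\<Union>e\<in>set es. ends G e)"
  proof
    fix v assume "v \<in> set vs"
    then obtain i where i: "i < length vs" "vs ! i = v" by (auto simp: in_set_conv_nth)
    show "v \<in> (\<Union>e\<in>set es. ends G e)"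
    proof (cases "i < length es")
      case True
      then show ?thesis using p(1) i by (auto simp: upath_def intro!: bexI[of _ "es ! i"])
    next
      case False
      \<comment> \<open>The last vertex starts no edge; it is the second end of the last
        one.\<close>
      then have "i = Suc (length es - 1)" "length es - 1 < length es"
        using p(1) i \<open>es \<noteq> []\<close> by (auto simp: upath_def)
      then show ?thesis using p(1) i by (auto simp: upath_def intro!: bexI[of _ "es ! (length es - 1)"])
    qed
  qed
  have "subgraph ?Q (edge_induced G I)"
    unfolding subgraph_def
  proof (intro conjI)
    show "graph ?Q"
      unfolding graph_def
    proof (intro conjI ballI)
      fix e assume "e \<in> edges ?Q"
      then have "e \<in> I" "e = f \<or> e \<in> set es" using p(2,3) C(1) by auto
      then show "ends ?Q e \<subseteq> verts ?Q" "card (ends ?Q e) = 2"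
        using p(5) two upath_edge_subset[OF p(1)] upath_neq_Nil[OF p(1)] by auto
    qed auto
    show "verts ?Q \<subseteq> verts (edge_induced G I)"
      using vsub p C by (fastforce simp: edge_induced_def)
  qed (use p C in \<open>auto simp: edge_induced_def\<close>)
  then show ?thesis
    using is_cycleI[OF p(1,4,5)] by (auto simp: is_forest_def)
qed

text \<open>The bridge from forests to linear algebra over \<open>GF(2)\<close>. That independent
  sets are forests rests on the edge set of a cycle being even.\<close>

lemma is_forest_iff:
  assumes "graph G" "I \<subseteq> edges G"
  shows "is_forest (edge_induced G I) \<longleftrightarrow> acyclic_set (ends G) I"
proof
  show "is_forest (edge_induced G I) \<Longrightarrow> acyclic_set (ends G) I"
    using dependent_set_not_forest[OF assms] by blast
  assume ac: "acyclic_set (ends G) I"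
  show "is_forest (edge_induced G I)"
    unfolding is_forest_def
  proof
    assume "\<exists>Q. subgraph Q (edge_induced G I) \<and> is_cycle Q"
    then obtain Q where Q: "subgraph Q (edge_induced G I)" "is_cycle Q" by blast
    then have "even_set (ends Q) (edges Q)" "edges Q \<noteq> {}" "edges Q \<subseteq> I"
      "\<forall>e\<in>edges Q. ends Q e = ends G e"
      using is_cycle_even_set by (auto simp: subgraph_def edge_induced_def)
    then have "even_set (ends G) (edges Q)"
      using even_set_cong[of "edges Q" "ends Q" "ends G"] by blast
    then show False
      using ac \<open>edges Q \<noteq> {}\<close> \<open>edges Q \<subseteq> I\<close> by (auto simp: acyclic_set_def)
  qed
qed

subsection \<open>Bases and truncation\<close>

lemma bases_cycle_matroid:
  assumes "graph G"
  shows "bases (cycle_matroid G) = {B. B \<subseteq> edges G \<and> acyclic_set (ends G) B \<and>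
    (\<forall>B'. B \<subset> B' \<and> B' \<subseteq> edges G \<longrightarrow> \<not> acyclic_set (ends G) B')}"
  using is_forest_iff[OF assms] by (auto simp: cycle_matroid_def)

lemma acyclic_set_extends_to_base:
  assumes "graph G" "I \<subseteq> edges G" "acyclic_set (ends G) I"
  obtains B where "B \<in> bases (cycle_matroid G)" "I \<subseteq> B"
proof -
  let ?A = "{J. I \<subseteq> J \<and> J \<subseteq> edges G \<and> acyclic_set (ends G) J}"
  have "finite ?A"
    using assms(1) by (auto simp: graph_def intro: finite_subset[of _ "Pow (edges G)"])
  moreover have "I \<in> ?A" using assms by simp
  ultimately have "\<exists>B\<in>?A. I \<subseteq> B \<and> (\<forall>J\<in>?A. B \<subseteq> J \<longrightarrow> B = J)"
    by (rule finite_has_maximal2)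
  then obtain B where B: "I \<subseteq> B" "B \<subseteq> edges G" "acyclic_set (ends G) B"
    and mx: "\<forall>J\<in>?A. B \<subseteq> J \<longrightarrow> B = J"
    by auto
  have "\<not> acyclic_set (ends G) J" if "B \<subset> J" "J \<subseteq> edges G" for J
    using mx that B(1) by auto
  then have "B \<in> bases (cycle_matroid G)"
    using B unfolding bases_cycle_matroid[OF assms(1)] by simp
  then show ?thesis using B(1) by (rule that)
qed

text \<open>By maximality, each edge outside \<open>B\<close> closes an even set with edges of
  \<open>B\<close>. Adding these up replaces any \<open>S\<close> by a subset of \<open>B\<close>
  with the same boundary.\<close>

lemma base_spans:
  assumes G: "graph G" and B: "B \<in> bases (cycle_matroid G)" and S: "S \<subseteq> edges G"
  shows "\<exists>S'\<subseteq>B. even_set (ends G) (sym_diff S S')"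
proof -
  have BE: "B \<subseteq> edges G" and ac: "acyclic_set (ends G) B"
    and mx: "\<And>B'. B \<subset> B' \<Longrightarrow> B' \<subseteq> edges G \<Longrightarrow> \<not> acyclic_set (ends G) B'"
    using B unfolding bases_cycle_matroid[OF G] by auto
  have fin: "finite (edges G)" using G by (simp add: graph_def)
  have "finite S" using S fin by (rule finite_subset)
  then show ?thesis
    using S
  proof (induction S rule: finite_induct)
    case empty
    show ?case by (rule exI[of _ "{}"]) (simp add: even_set_def)
  next
    case (insert e S)
    then obtain S' where S': "S' \<subseteq> B" "even_set (ends G) (sym_diff S S')" by auto
    show ?case
    proof (cases "e \<in> B")
      case True
      \<comment> \<open>An edge of \<open>B\<close> represents itself; toggling it on both sides
        leaves the sum unchanged.\<close>
      have "sym_diff (insert e S) (sym_diff S' {e}) = sym_diff S S'"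
        using insert.hyps by auto
      then show ?thesis using S' True by (intro exI[of _ "sym_diff S' {e}"]) auto
    next
      case False
      then have "\<not> acyclic_set (ends G) (insert e B)"
        using mx[of "insert e B"] BE insert.prems by auto
      then obtain C where C: "C \<subseteq> insert e B" "even_set (ends G) C" "C \<noteq> {}"
        by (auto simp: acyclic_set_def)
      have "e \<in> C"
        using C ac by (auto simp: acyclic_set_def)
      \<comment> \<open>Adding \<open>C\<close> trades \<open>e\<close> for \<open>C - {e}\<close>,
        which lies in \<open>B\<close>.\<close>
      have eq: "sym_diff (insert e S) (sym_diff S' (C - {e})) = sym_diff (sym_diff S S') C"
        using insert.hyps \<open>e \<in> C\<close> False S'(1) by auto
      have "sym_diff S S' \<subseteq> edges G" "C \<subseteq> edges G"
        using BE insert.prems S'(1) C(1) by auto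
      then have fins: "finite (sym_diff S S')" "finite C"
        using fin finite_subset by blast+
      have "even_set (ends G) (sym_diff (insert e S) (sym_diff S' (C - {e})))"
        unfolding eq by (rule even_set_sym_diff[OF fins S'(2) C(2)])
      moreover have "sym_diff S' (C - {e}) \<subseteq> B"
        using S'(1) C(1) by auto
      ultimately show ?thesis by blast
    qed
  qed
qed

text \<open>Modulo even sets, the subsets of an acyclic set embed into the subsets of a base.\<close>

lemma acyclic_set_card_le_base:
  assumes G: "graph G" and B: "B \<in> bases (cycle_matroid G)"
    and T: "T \<subseteq> edges G" "acyclic_set (ends G) T"
  shows "card T \<le> card B"
proof -
  have fin: "finite (edges G)" using G by (simp add: graph_def)
  have BE: "B \<subseteq> edges G"
    using B unfolding bases_cycle_matroid[OF G] by auto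
  obtain h where h: "\<And>S. S \<subseteq> T \<Longrightarrow> h S \<subseteq> B \<and> even_set (ends G) (sym_diff S (h S))"
    using base_spans[OF G B] T(1) by (metis subset_trans)
  \<comment> \<open>If \<open>h S = h U\<close>, the representatives cancel and
    \<open>sym_diff S U\<close> is an even subset of \<open>T\<close>.\<close>
  have "inj_on h (Pow T)"
  proof (rule inj_onI)
    fix S U assume SU: "S \<in> Pow T" "U \<in> Pow T" "h S = h U"
    have "S \<subseteq> edges G" "U \<subseteq> edges G" "h S \<subseteq> edges G"
      using SU T(1) BE h[of S] by auto
    then have "finite S" "finite U" "finite (h S)"
      using fin finite_subset by blast+
    moreover have "even_set (ends G) (sym_diff S (h S))" "even_set (ends G) (sym_diff U (h U))"
      using SU h by blast+
    ultimately have "even_set (ends G) (sym_diff (sym_diff S (h S)) (sym_diff U (h U)))"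
      using SU(3) by (intro even_set_sym_diff[of "sym_diff S (h S)" "sym_diff U (h U)"]) auto
    moreover have "sym_diff (sym_diff S (h S)) (sym_diff U (h U)) = sym_diff S U"
      using SU by auto
    ultimately have "even_set (ends G) (sym_diff S U)" by metis
    moreover have "sym_diff S U \<subseteq> T" using SU by auto
    ultimately have "sym_diff S U = {}"
      using T(2) unfolding acyclic_set_def by metis
    then show "S = U" by blast
  qed
  moreover have "h ` Pow T \<subseteq> Pow B" using h by auto
  moreover have "finite B" "finite T" using BE T(1) fin finite_subset by blast+
  ultimately have "2 ^ card T \<le> (2 :: nat) ^ card B"
    using card_inj_on_le[of h "Pow T" "Pow B"] by (simp add: card_Pow)
  then show ?thesis by simp
qed

text \<open>\<open>T\<close> forces a rank above \<open>card I\<close>, so a base of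
  \<open>G\<close> containing \<open>I\<close> has a further element \<open>x\<close>. Without
  \<open>x\<close> it is a base of the truncation, hence lies inside a base of
  \<open>F\<close>.\<close>

lemma acyclic_set_transfer_truncation:
  assumes G: "graph G" and F: "graph F"
    and eq: "truncated_cycle_matroid G = truncated_cycle_matroid F"
    and T: "T \<subseteq> edges G" "acyclic_set (ends G) T"
    and I: "I \<subseteq> edges G" "card I < card T" "acyclic_set (ends G) I"
  shows "acyclic_set (ends F) I"
proof -
  obtain B where B: "B \<in> bases (cycle_matroid G)" "I \<subseteq> B"
    using acyclic_set_extends_to_base G I by metis
  have "card I < card B"
    using acyclic_set_card_le_base[OF G B(1) T] I(2) by simp
  then have "I \<noteq> B" by blast
  then obtain x where x: "x \<in> B" "x \<notin> I" using B by blast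
  then have "B - {x} \<in> bases (truncated_cycle_matroid G)"
    using B by (auto simp: truncated_cycle_matroid_def truncation_def)
  then obtain B' x' where B': "B' \<in> bases (cycle_matroid F)" "B - {x} = B' - {x'}"
    unfolding eq by (auto simp: truncated_cycle_matroid_def truncation_def)
  then have "I \<subseteq> B'" using B x by blast
  moreover have "acyclic_set (ends F) B'"
    using B'(1) unfolding bases_cycle_matroid[OF F] by simp
  ultimately show ?thesis
    by (rule acyclic_set_subset[rotated])
qed

text \<open>For the converse the roles are swapped, which calls for an independent set of
  \<open>F\<close> larger than \<open>I\<close>. A base \<open>B'\<close> of \<open>F\<close> that
  shares a truncation base with \<open>B\<close> has as many edges as \<open>B\<close> and
  serves.\<close>

lemma acyclic_set_iff_truncation:
  assumes G: "graph G" and F: "graph F" and E: "edges G = edges F"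
    and eq: "truncated_cycle_matroid G = truncated_cycle_matroid F"
    and T: "T \<subseteq> edges G" "acyclic_set (ends G) T"
    and I: "I \<subseteq> edges G" "card I < card T"
  shows "acyclic_set (ends G) I \<longleftrightarrow> acyclic_set (ends F) I"
proof
  show "acyclic_set (ends G) I \<Longrightarrow> acyclic_set (ends F) I"
    using acyclic_set_transfer_truncation[OF G F eq T I] .
  assume acI: "acyclic_set (ends F) I"
  obtain B where B: "B \<in> bases (cycle_matroid G)" "T \<subseteq> B"
    using acyclic_set_extends_to_base G T by metis
  obtain x where x: "x \<in> B"
    using B(2) I(2) by (cases "T = {}") auto
  have "B - {x} \<in> bases (truncated_cycle_matroid G)"
    using B x by (auto simp: truncated_cycle_matroid_def truncation_def)
  then obtain B' x' where B': "B' \<in> bases (cycle_matroid F)" "B - {x} = B' - {x'}" "x' \<in> B'"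
    unfolding eq by (auto simp: truncated_cycle_matroid_def truncation_def)
  have B'F: "B' \<subseteq> edges F" "acyclic_set (ends F) B'"
    using B'(1) unfolding bases_cycle_matroid[OF F] by auto
  have "B \<subseteq> edges G"
    using B(1) unfolding bases_cycle_matroid[OF G] by simp
  then have finB: "finite B" "finite B'"
    using B'F(1) G F finite_subset by (auto simp: graph_def)
  have "card B = card B'"
    using finB x B'(2,3) by (metis card_Suc_Diff1)
  moreover have "card T \<le> card B"
    using B(2) finB by (simp add: card_mono)
  ultimately have "card I < card B'" using I(2) by simp
  then show "acyclic_set (ends G) I"
    using acyclic_set_transfer_truncation[OF F G eq[symmetric] B'F _ _ acI] I(1) E by simp
qed

subsection \<open>Connectivity\<close>

text \<open>A walk may repeat edges; \<open>Y\<close> collects those used an odd number of times, by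
  adding one edge after the other modulo 2.\<close>

lemma odd_at_walk:
  assumes "(adjacent H)\<^sup>*\<^sup>* u v" "finite (edges H)" "graph H"
  shows "\<exists>Y\<subseteq>edges H. \<forall>w. odd_at (ends H) Y w \<longleftrightarrow> (w = u) \<noteq> (w = v)"
  using assms(1)
proof (induction rule: rtranclp_induct)
  case base
  show ?case by (rule exI[of _ "{}"]) auto
next
  case (step v z)
  then obtain Y where Y: "Y \<subseteq> edges H" "\<And>w. odd_at (ends H) Y w \<longleftrightarrow> (w = u) \<noteq> (w = v)"
    by blast
  obtain e where e: "e \<in> edges H" "ends H e = {v, z}"
    using step.hyps by (auto simp: adjacent_def)
  then have "v \<noteq> z"
    using assms(3) by (auto simp: graph_def)
  have "odd_at (ends H) (sym_diff Y {e}) w \<longleftrightarrow> (w = u) \<noteq> (w = z)" for w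
    using Y e \<open>v \<noteq> z\<close> finite_subset[OF Y(1) assms(2)] odd_at_insert[of "{}" e "ends H" w]
    by (subst odd_at_sym_diff) auto
  moreover have "sym_diff Y {e} \<subseteq> edges H" using Y e by auto
  ultimately show ?case by blast
qed

text \<open>A vertex set \<open>S\<close> spanning at least \<open>card S - 1\<close> edges grows by
  any edge that leaves it, so a maximal one is everything. Applied to the spanning tree, this bounds
  the number of vertices of \<open>F\<close>.\<close>

lemma connected_card_verts_le:
  assumes "graph_connected H" "finite (edges H)" "graph H"
  shows "card (verts H) \<le> Suc (card (edges H))"
proof -
  let ?P = "\<lambda>S. S \<subseteq> verts H \<and> S \<noteq> {} \<and>
      (\<exists>T\<subseteq>edges H. (\<forall>e\<in>T. ends H e \<subseteq> S) \<and> card S \<le> Suc (card T))"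
  have fin: "finite (verts H)" using assms(3) by (simp add: graph_def)
  obtain v0 where "v0 \<in> verts H" using assms(1) by (auto simp: graph_connected_def)
  then have "?P {v0}" by (auto intro!: exI[of _ "{}"])
  moreover have "finite {S. ?P S}"
    using fin by (auto intro: finite_subset[of _ "Pow (verts H)"])
  moreover from calculation have "{v0} \<in> {S. ?P S}" by simp
  ultimately have "\<exists>S\<in>{S. ?P S}. {v0} \<subseteq> S \<and> (\<forall>S'\<in>{S. ?P S}. S \<subseteq> S' \<longrightarrow> S = S')"
    by (intro finite_has_maximal2)
  then obtain S where S: "?P S" and mx: "\<And>S'. ?P S' \<Longrightarrow> S \<subseteq> S' \<Longrightarrow> S = S'"
    by auto
  obtain T where T: "T \<subseteq> edges H" "\<forall>e\<in>T. ends H e \<subseteq> S" "card S \<le> Suc (card T)"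
    using S by blast
  have finT: "finite T" using T(1) assms(2) by (rule finite_subset)
  have "S = verts H"
  proof (rule ccontr)
    assume "S \<noteq> verts H"
    then obtain u v where uv: "u \<in> S" "v \<in> verts H - S" using S by blast
    then have "(adjacent H)\<^sup>*\<^sup>* u v"
      using assms(1) S by (auto simp: graph_connected_def)
    then have "v \<in> S"
      using uv(1)
    proof (induction rule: rtranclp_induct)
      case (step y z)
      show ?case
      proof (rule ccontr)
        assume "z \<notin> S"
        obtain e where e: "e \<in> edges H" "ends H e = {y, z}"
          using step.hyps by (auto simp: adjacent_def)
        have "e \<notin> T" using T(2) e \<open>z \<notin> S\<close> by auto
        have "finite S" using S fin finite_subset by blast
        have "z \<in> verts H" using e assms(3) by (auto simp: graph_def)
        have "?P (insert z S)"
        proof (intro conjI exI[of _ "insert e T"])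
          show "card (insert z S) \<le> Suc (card (insert e T))"
            using \<open>e \<notin> T\<close> \<open>z \<notin> S\<close> \<open>finite S\<close> finT T(3) by simp
        qed (use S T e step \<open>z \<in> verts H\<close> in auto)
        then show False using mx[of "insert z S"] \<open>z \<notin> S\<close> by auto
      qed
    qed
    then show False using uv by simp
  qed
  then show ?thesis
    using T card_mono[OF assms(2) T(1)] by simp
qed

section \<open>Connectivity from Hamiltonian paths and cycles\<close>

lemma adjacent_commute: "adjacent H u v \<Longrightarrow> adjacent H v u"
  by (auto simp: adjacent_def insert_commute)

lemma graph_connected_if_hamiltonian_path:
  assumes "ws \<noteq> []" "verts H = set ws"
    and adj: "\<And>i. Suc i < length ws \<Longrightarrow> adjacent H (ws ! i) (ws ! Suc i)"
  shows "graph_connected H"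
proof -
  have "symp (adjacent H)"
    by (rule sympI) (rule adjacent_commute)
  then have sym: "symp (adjacent H)\<^sup>*\<^sup>*" by (rule symp_rtranclp)
  have "i < length ws \<Longrightarrow> (adjacent H)\<^sup>*\<^sup>* (ws ! 0) (ws ! i)" for i
  proof (induction i)
    case (Suc i)
    then show ?case
      using adj[of i] by (simp add: rtranclp.rtrancl_into_rtrancl)
  qed simp
  then have "v \<in> set ws \<Longrightarrow> (adjacent H)\<^sup>*\<^sup>* (ws ! 0) v" for v
    by (auto simp: in_set_conv_nth)
  then show ?thesis
    using assms(1,2) sym unfolding graph_connected_def
    by (metis rtranclp_trans set_empty sympD)
qed

text \<open>Deleting a vertex from a Hamiltonian cycle leaves a Hamiltonian path; rotating the cycle
  to start at the deleted vertex makes this path the tail of the list.\<close>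

lemma two_connected_if_hamiltonian_cycle:
  assumes vs: "verts G = set vs" "distinct vs" "3 \<le> length vs"
    and adj: "\<And>i. i < length vs \<Longrightarrow> adjacent G (vs ! i) (vs ! (Suc i mod length vs))"
  shows "two_connected G"
  unfolding two_connected_def
proof (intro conjI ballI)
  show "3 \<le> card (verts G)" using vs by (simp add: distinct_card)
  show "graph_connected G"
  proof (rule graph_connected_if_hamiltonian_path)
    show "vs \<noteq> []" using vs(3) by auto
    show "adjacent G (vs ! i) (vs ! Suc i)" if "Suc i < length vs" for i
      using adj[of i] that by simp
  qed (rule vs(1))
  fix v assume "v \<in> verts G"
  then obtain k where k: "k < length vs" "vs ! k = v"
    using vs by (auto simp: in_set_conv_nth)
  let ?m = "length vs"
  let ?us = "rotate k vs"
  have "0 < ?m" using k by linarith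
  then have "?us \<noteq> []" by auto
  have nth: "?us ! i = vs ! ((k + i) mod ?m)" if "i < ?m" for i
    using that by (simp add: nth_rotate)
  have "hd ?us = v"
    using nth[of 0] k \<open>?us \<noteq> []\<close> by (simp add: hd_conv_nth)
  then obtain ws where ws: "?us = v # ws"
    using \<open>?us \<noteq> []\<close> by (cases ?us) auto
  have dist: "v \<notin> set ws" "distinct ws"
    using vs(2) ws by (metis distinct.simps(2) distinct_rotate)+
  have set: "set vs = insert v (set ws)"
    using ws by (metis list.simps(15) set_rotate)
  have len: "?m = Suc (length ws)"
    using ws by (metis length_Cons length_rotate)
  show "graph_connected (delete_vertex G v)"
  proof (rule graph_connected_if_hamiltonian_path)
    show "ws \<noteq> []" using vs(3) len by auto
    show "verts (delete_vertex G v) = set ws"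
      using vs(1) set dist by (auto simp: delete_vertex_def)
    fix i assume i: "Suc i < length ws"
    have "ws ! i = vs ! ((k + Suc i) mod ?m)"
      using nth[of "Suc i"] ws i len by simp
    moreover have "ws ! Suc i = vs ! (Suc ((k + Suc i) mod ?m) mod ?m)"
      using nth[of "Suc (Suc i)"] ws i len by (simp add: mod_Suc_eq)
    moreover have "(k + Suc i) mod ?m < ?m" using \<open>0 < ?m\<close> by simp
    ultimately have "adjacent G (ws ! i) (ws ! Suc i)"
      using adj by metis
    moreover have "ws ! i \<in> set ws" "ws ! Suc i \<in> set ws" using i by auto
    ultimately show "adjacent (delete_vertex G v) (ws ! i) (ws ! Suc i)"
      using dist by (auto simp: adjacent_def delete_vertex_def)
  qed
qed

subsection \<open>Subdivisions of one edge of \<open>K\<^sub>4\<close>\<close>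

text \<open>A subdivision of \<open>K\<^sub>4\<close> on the vertices \<open>a\<close>, \<open>b\<close>, \<open>p = hd ws\<close> and \<open>q = last ws\<close> in which
  only the edge \<open>pq\<close> is subdivided; \<open>y\<^sub>1 = pa\<close>, \<open>z\<^sub>1 = pb\<close>, \<open>z\<^sub>2 = qb\<close>, \<open>y\<^sub>2 = qa\<close>, \<open>s = ab\<close>.\<close>

definition path_K4 ::
  "('v, 'e) mgraph \<Rightarrow> 'v \<Rightarrow> 'v \<Rightarrow> 'v list \<Rightarrow> 'e list \<Rightarrow> 'e \<Rightarrow> 'e \<Rightarrow> 'e \<Rightarrow> 'e \<Rightarrow> 'e \<Rightarrow> bool" where
  "path_K4 H a b ws L y1 z1 z2 y2 s \<longleftrightarrow>
     verts H = insert a (insert b (set ws)) \<and> a \<noteq> b \<and> a \<notin> set ws \<and> b \<notin> set ws \<and>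
     edges H = {y1, z1, z2, y2, s} \<union> set L \<and> distinct ([y1, z1, z2, y2, s] @ L) \<and>
     upath (ends H) ws L \<and> ends H y1 = {hd ws, a} \<and> ends H z1 = {hd ws, b} \<and>
     ends H z2 = {last ws, b} \<and> ends H y2 = {last ws, a} \<and> ends H s = {a, b}"

section \<open>Exchanges and Whitney switches in a subdivided \<open>K4\<close>\<close>

lemma upath_cong:
  "(\<And>e. e \<in> set es \<Longrightarrow> \<phi> e = \<psi> e) \<Longrightarrow> upath \<phi> vs es \<longleftrightarrow> upath \<psi> vs es"
  by (simp add: upath_def)

text \<open>Both edges end at \<open>hd ws\<close>, one going to \<open>a\<close> and one to
  \<open>b\<close>, so the exchange merely swaps their roles while all vertices keep theirs.\<close>

lemma path_K4_exchange_edges: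
  assumes "path_K4 H a b ws L y1 z1 z2 y2 s"
  shows "path_K4 (exchange_edges z1 y1 H) a b ws L z1 y1 z2 y2 s"
proof -
  have "upath (ends (exchange_edges z1 y1 H)) ws L \<longleftrightarrow> upath (ends H) ws L"
    by (rule upath_cong) (use assms in \<open>auto simp: path_K4_def exchange_edges_def\<close>)
  then show ?thesis
    using assms by (auto simp: path_K4_def exchange_edges_def)
qed

lemma path_K4_edge_ends:
  assumes "path_K4 H a b ws L y1 z1 z2 y2 s" "e \<in> edges H"
  shows "ends H e \<subseteq> verts H \<and> card (ends H e) = 2"
proof -
  have path: "upath (ends H) ws L" using assms(1) by (simp add: path_K4_def)
  have ne: "ws \<noteq> []" using path by (rule upath_neq_Nil)
  show ?thesis
  proof (cases "e \<in> set L")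
    case True
    then obtain i where i: "i < length L" "L ! i = e" by (auto simp: in_set_conv_nth)
    then have "ends H e = {ws ! i, ws ! Suc i}" "ws ! i \<noteq> ws ! Suc i"
      using path by (auto simp: upath_def nth_eq_iff_index_eq)
    moreover have "ends H e \<subseteq> set ws" using upath_edge_subset path True by metis
    ultimately show ?thesis using assms(1) by (auto simp: path_K4_def)
  next
    case False
    moreover have "hd ws \<in> set ws" "last ws \<in> set ws" using ne by auto
    ultimately show ?thesis
      using assms by (auto simp: path_K4_def card_2_iff)
  qed
qed

text \<open>The vertex \<open>m\<close> between \<open>x\<close> and \<open>y\<close> has degree
  two, so the path formed by \<open>x\<close> and \<open>y\<close> meets the rest of the graph only
  in its ends \<open>u\<close> and \<open>v\<close>. Switching there reverses this path, which
  transposes its two edges.\<close>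

lemma path_K4_swap:
  assumes K: "path_K4 K a b ws (as @ [x, y] @ bs) y1 z1 z2 y2 s"
  shows "\<exists>K'. whitney_switch K K' \<and> path_K4 K' a b ws (as @ [y, x] @ bs) y1 z1 z2 y2 s"
proof -
  let ?L = "as @ [x, y] @ bs"
  let ?i = "length as"
  define u m v where "u = ws ! ?i" and "m = ws ! Suc ?i" and "v = ws ! Suc (Suc ?i)"
  have path: "upath (ends K) ws ?L" using K by (simp add: path_K4_def)
  have dist: "distinct ws" and len: "length ws = Suc (length ?L)"
    and nth: "\<And>j. j < length ?L \<Longrightarrow> ends K (?L ! j) = {ws ! j, ws ! Suc j}"
    using path unfolding upath_def by blast+
  have len': "Suc (Suc ?i) < length ws" using len by simp
  have x: "ends K x = {u, m}" using nth[of ?i] by (simp add: u_def m_def)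
  have y: "ends K y = {m, v}" using nth[of "Suc ?i"] by (simp add: v_def m_def nth_append)
  have uvm: "u \<noteq> v" "u \<noteq> m" "m \<noteq> v" "u \<in> set ws" "v \<in> set ws" "m \<in> set ws"
    using dist len' by (auto simp: u_def v_def m_def nth_eq_iff_index_eq)
  have xy: "x \<noteq> y" "x \<notin> {y1, z1, z2, y2, s}" "y \<notin> {y1, z1, z2, y2, s}"
    using K by (auto simp: path_K4_def)
  have ne: "ws \<noteq> []" using path by (rule upath_neq_Nil)
  \<comment> \<open>\<open>m\<close> is an inner vertex of \<open>ws\<close>, so the five edges
    outside the path miss it as well.\<close>
  have hl: "hd ws \<noteq> m" "last ws \<noteq> m"
    using dist len len' ne by (auto simp: m_def hd_conv_nth last_conv_nth nth_eq_iff_index_eq)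
  have other: "m \<notin> ends K e" if e: "e \<in> edges K" "e \<noteq> x" "e \<noteq> y" for e
  proof (cases "e \<in> set ?L")
    case True
    then obtain j where j: "j < length ?L" "?L ! j = e"
      by (metis in_set_conv_nth)
    then have "j \<noteq> ?i" "j \<noteq> Suc ?i" using e by (auto simp: nth_append)
    then show ?thesis
      using nth[OF j(1)] j dist len len' by (auto simp: m_def nth_eq_iff_index_eq)
  next
    case False
    then show ?thesis using e(1) K hl uvm by (auto simp: path_K4_def)
  qed
  define A where "A = \<lparr>verts = {u, m, v}, edges = {x, y}, ends = ends K\<rparr>"
  \<comment> \<open>All remaining edges miss \<open>m\<close>, so \<open>B\<close> can drop it and
    shares exactly \<open>u\<close> and \<open>v\<close> with \<open>A\<close>.\<close>
  define B where "B = \<lparr>verts = verts K - {m}, edges = edges K - {x, y}, ends = ends K\<rparr>"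
  define K' where
    "K' = K\<lparr>ends := (\<lambda>e. if e \<in> edges A then transpose u v ` ends K e else ends K e)\<rparr>"
  have vK: "{u, m, v} \<subseteq> verts K" and eK: "{x, y} \<subseteq> edges K"
    and fin: "finite (verts K)" "finite (edges K)"
    using K uvm by (auto simp: path_K4_def)
  have "subgraph A K"
    using vK eK x y uvm by (auto simp: A_def subgraph_def graph_def)
  moreover have "subgraph B K"
    using path_K4_edge_ends[OF K] other fin by (auto simp: B_def subgraph_def graph_def)
  moreover have "verts A \<union> verts B = verts K" "verts A \<inter> verts B = {u, v}"
    "edges A \<union> edges B = edges K" "edges A \<inter> edges B = {}"
    using vK eK uvm by (auto simp: A_def B_def)
  ultimately have "whitney_switch K K'"
    unfolding whitney_switch_def K'_def using uvm(1) by blast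
  moreover have "path_K4 K' a b ws (as @ [y, x] @ bs) y1 z1 z2 y2 s"
  proof -
    have ends_other: "ends K' e = ends K e" if "e \<noteq> x" "e \<noteq> y" for e
      using that by (simp add: K'_def A_def)
    have ends_xy: "ends K' x = {m, v}" "ends K' y = {u, m}"
      using x y uvm by (auto simp: K'_def A_def transpose_def)
    have "ends K' ((as @ [y, x] @ bs) ! j) = {ws ! j, ws ! Suc j}" if j: "j < length ?L" for j
    proof -
      consider "j = ?i" | "j = Suc ?i" | "j < ?i" | "j > Suc ?i" by linarith
      then show ?thesis
      proof cases
        case 1
        then show ?thesis using ends_xy by (simp add: u_def m_def)
      next
        case 2
        then show ?thesis using ends_xy by (simp add: v_def m_def nth_append)
      next
        case 3
        then have "(as @ [y, x] @ bs) ! j = ?L ! j" "?L ! j \<in> set as"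
          by (simp_all add: nth_append)
        moreover from this have "?L ! j \<noteq> x" "?L ! j \<noteq> y"
          using K by (auto simp: path_K4_def)
        ultimately show ?thesis using nth[OF j] ends_other by metis
      next
        case 4
        then obtain l where l: "j = Suc (Suc ?i) + l" by (metis Suc_leI le_iff_add)
        then have "(as @ [y, x] @ bs) ! j = ?L ! j" "?L ! j \<in> set bs"
          using j by (simp_all add: nth_append)
        moreover from this have "?L ! j \<noteq> x" "?L ! j \<noteq> y"
          using K by (auto simp: path_K4_def)
        ultimately show ?thesis using nth[OF j] ends_other by metis
      qed
    qed
    then have "upath (ends K') ws (as @ [y, x] @ bs)"
      using dist len by (simp add: upath_def)
    moreover have "ends K' e = ends K e" if "e \<in> {y1, z1, z2, y2, s}" for e
      by (rule ends_other) (use that xy in auto)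
    moreover have "verts K' = verts K" "edges K' = edges K" by (simp_all add: K'_def)
    ultimately show ?thesis
      using K by (auto simp: path_K4_def)
  qed
  ultimately show ?thesis by blast
qed

text \<open>Each switch moves \<open>y\<close> leftwards past one edge of \<open>as\<close>.\<close>

lemma path_K4_move_to_front:
  assumes "path_K4 K a b ws (pre @ as @ y # bs) y1 z1 z2 y2 s"
  shows "\<exists>K'. whitney_switch\<^sup>*\<^sup>* K K' \<and> path_K4 K' a b ws (pre @ y # as @ bs) y1 z1 z2 y2 s"
  using assms
proof (induction as arbitrary: K bs rule: rev_induct)
  case (snoc x as)
  then have "path_K4 K a b ws ((pre @ as) @ [x, y] @ bs) y1 z1 z2 y2 s" by simp
  then obtain K1 where K1: "whitney_switch K K1"
    "path_K4 K1 a b ws ((pre @ as) @ [y, x] @ bs) y1 z1 z2 y2 s"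
    using path_K4_swap by metis
  then obtain K' where "whitney_switch\<^sup>*\<^sup>* K1 K'"
    "path_K4 K' a b ws (pre @ y # as @ x # bs) y1 z1 z2 y2 s"
    using snoc.IH[of K1 "x # bs"] by auto
  then show ?case
    using K1(1) by (intro exI[of _ K']) (auto intro: converse_rtranclp_into_rtranclp)
qed auto

text \<open>Selection sort by switches; \<open>pre\<close> is the part already in its final
  order.\<close>

lemma path_K4_permute:
  assumes "path_K4 K a b ws (pre @ L) y1 z1 z2 y2 s" "mset L = mset L'"
  shows "\<exists>K'. whitney_switch\<^sup>*\<^sup>* K K' \<and> path_K4 K' a b ws (pre @ L') y1 z1 z2 y2 s"
  using assms
proof (induction L' arbitrary: K pre L)
  case (Cons y L')
  then have "y \<in> set L" by (metis list.set_intros(1) set_mset_mset)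
  then obtain as bs where L: "L = as @ y # bs" by (meson split_list)
  then obtain K1 where K1: "whitney_switch\<^sup>*\<^sup>* K K1"
    "path_K4 K1 a b ws ((pre @ [y]) @ (as @ bs)) y1 z1 z2 y2 s"
    using path_K4_move_to_front[of K a b ws pre as y bs y1 z1 z2 y2 s] Cons.prems(1) by auto
  have "mset (as @ bs) = mset L'" using Cons.prems(2) L by simp
  from Cons.IH[OF K1(2) this] obtain K' where "whitney_switch\<^sup>*\<^sup>* K1 K'"
    "path_K4 K' a b ws (pre @ y # L') y1 z1 z2 y2 s" by auto
  then show ?case
    using K1(1) rtranclp_trans[of whitney_switch K K1 K'] by blast
qed auto

section \<open>Isomorphisms and 2-connectedness of subdivided \<open>K4\<close> graphs\<close>

lemma ex_map_eq:
  assumes "distinct xs" "length xs = length ys"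
  shows "\<exists>f. map f xs = ys"
proof
  show "map (\<lambda>x. the (map_of (zip xs ys) x)) xs = ys"
    by (rule nth_equalityI) (use assms in \<open>auto simp: map_of_zip_nth\<close>)
qed

text \<open>The vertices are matched in the order \<open>a\<close>, \<open>b\<close>,
  \<open>ws\<close>. Comparing end pairs by position serves both the isomorphisms that keep the edge
  labels and those that change them.\<close>

lemma path_K4_vertex_map:
  assumes G: "path_K4 G a b ws L y1 z1 z2 y2 s"
    and F: "path_K4 F a' b' ws' L' y1' z1' z2' y2' s'" and "length L = length L'"
  obtains f where "bij_betw f (verts G) (verts F)"
    "map ((`) f \<circ> ends G) ([y1, z1, z2, y2, s] @ L) = map (ends F) ([y1', z1', z2', y2', s'] @ L')"
proof -
  have pG: "upath (ends G) ws L" and pF: "upath (ends F) ws' L'"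
    using G F by (auto simp: path_K4_def)
  have len: "length (a # b # ws) = length (a' # b' # ws')"
    using pG pF assms(3) by (simp add: upath_def)
  have dG: "distinct (a # b # ws)" and dF: "distinct (a' # b' # ws')"
    using G F pG pF by (auto simp: path_K4_def upath_def)
  obtain f where f: "map f (a # b # ws) = a' # b' # ws'"
    using ex_map_eq[OF dG len] by (rule exE)
  then have fs: "f a = a'" "f b = b'" "map f ws = ws'" by auto
  have ne: "ws \<noteq> []" using pG by (rule upath_neq_Nil)
  have fh: "f (hd ws) = hd ws'" "f (last ws) = last ws'"
    using fs(3) ne by (auto simp: hd_map last_map)
  have "inj_on f (set (a # b # ws))"
    using dF f by (metis distinct_map)
  moreover have "f ` set (a # b # ws) = set (a' # b' # ws')"
    using f by (metis set_map)
  ultimately have "bij_betw f (verts G) (verts F)"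
    using G F by (simp add: bij_betw_def path_K4_def)
  moreover have "map ((`) f \<circ> ends G) L = map (ends F) L'"
  proof (rule nth_equalityI)
    fix i assume "i < length (map ((`) f \<circ> ends G) L)"
    then have i: "i < length L" "i < length L'" using assms(3) by auto
    have "ws' ! i = f (ws ! i)" "ws' ! Suc i = f (ws ! Suc i)"
      using i pG fs(3) by (auto simp: upath_def)
    then show "map ((`) f \<circ> ends G) L ! i = map (ends F) L' ! i"
      using i pG pF by (simp add: upath_def)
  qed (use assms(3) in simp)
  ultimately show ?thesis
    using that[of f] G F fs fh by (simp add: path_K4_def)
qed

lemma path_K4_equal_up_to_vertex_names:
  assumes G: "path_K4 G a b ws L y1 z1 z2 y2 s"
    and F: "path_K4 F a' b' ws' L y1 z1 z2 y2 s"
  shows "equal_up_to_vertex_names G F"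
proof -
  obtain f where f: "bij_betw f (verts G) (verts F)"
    "map ((`) f \<circ> ends G) ([y1, z1, z2, y2, s] @ L) = map (ends F) ([y1, z1, z2, y2, s] @ L)"
    using path_K4_vertex_map[OF G F refl] .
  have "edges G = set ([y1, z1, z2, y2, s] @ L)" "edges F = edges G"
    using G F by (auto simp: path_K4_def)
  moreover have "\<forall>e\<in>set ([y1, z1, z2, y2, s] @ L). ends F e = f ` ends G e"
    using f(2) unfolding map_eq_conv by auto
  ultimately show ?thesis
    using f(1) unfolding equal_up_to_vertex_names_def by auto
qed

lemma path_K4_graph_isomorphic:
  assumes G: "path_K4 G a b ws L y1 z1 z2 y2 s"
    and F: "path_K4 F a' b' ws' L' y1' z1' z2' y2' s'" and len: "length L = length L'"
  shows "graph_isomorphic G F"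
proof -
  let ?es = "[y1, z1, z2, y2, s] @ L" and ?es' = "[y1', z1', z2', y2', s'] @ L'"
  obtain f where f: "bij_betw f (verts G) (verts F)"
    "map ((`) f \<circ> ends G) ?es = map (ends F) ?es'"
    using path_K4_vertex_map[OF G F len] .
  have es: "edges G = set ?es" "edges F = set ?es'" "distinct ?es" "distinct ?es'"
    using G F by (auto simp: path_K4_def)
  obtain g where g: "map g ?es = ?es'"
    using ex_map_eq[of ?es ?es'] es len by auto
  have "inj_on g (set ?es)" "g ` set ?es = set ?es'"
    using es(4) g by (metis distinct_map, metis set_map)
  then have "bij_betw g (edges G) (edges F)"
    by (simp only: bij_betw_def es)
  moreover have "map ((`) f \<circ> ends G) ?es = map (ends F \<circ> g) ?es"
    using f(2) g by (metis map_map)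
  then have "\<forall>e\<in>edges G. ends F (g e) = f ` ends G e"
    unfolding map_eq_conv es by auto
  ultimately show ?thesis
    using f(1) unfolding graph_isomorphic_def by blast
qed

text \<open>The edges \<open>s\<close>, \<open>z1\<close>, those of \<open>L\<close> and
  \<open>y2\<close> form a Hamiltonian cycle through \<open>a\<close>, \<open>b\<close>,
  \<open>ws\<close>.\<close>

lemma path_K4_two_connected:
  assumes K: "path_K4 K a b ws L y1 z1 z2 y2 s"
  shows "two_connected K"
proof (rule two_connected_if_hamiltonian_cycle)
  let ?vs = "a # b # ws"
  have path: "upath (ends K) ws L" using K by (simp add: path_K4_def)
  have ne: "ws \<noteq> []" using path by (rule upath_neq_Nil)
  show "verts K = set ?vs" "distinct ?vs" using K path by (auto simp: path_K4_def upath_def)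
  show "3 \<le> length ?vs" using ne by (cases ws) auto
  fix i assume i: "i < length ?vs"
  have adjI: "adjacent K u v" if "e \<in> edges K" "ends K e = {u, v}" for e u v
    using that by (auto simp: adjacent_def)
  consider "i = 0" | "i = 1" | j where "i = Suc (Suc j)" "j < length L" | "i = Suc (length ws)"
    using i path by (cases i; cases "i - 1") (auto simp: upath_def less_Suc_eq)
  then show "adjacent K (?vs ! i) (?vs ! (Suc i mod length ?vs))"
  proof cases
    case 1
    then show ?thesis using K by (auto intro!: adjI[of s] simp: path_K4_def)
  next
    case 2
    then show ?thesis using K ne
      by (auto intro!: adjI[of z1] simp: path_K4_def hd_conv_nth insert_commute)
  next
    case 3
    then show ?thesis using K path
      by (auto intro!: adjI[of "L ! j"] simp: path_K4_def upath_def)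
  next
    case 4
    then show ?thesis using K ne
      by (auto intro!: adjI[of y2] simp: path_K4_def last_conv_nth)
  qed
qed

subsection \<open>Structure of the two graphs\<close>

lemma upath_snoc:
  assumes "upath \<phi> vs es" "w \<notin> set vs" "\<phi> e = {last vs, w}"
  shows "upath \<phi> (vs @ [w]) (es @ [e])"
proof -
  have "upath \<phi> (w # rev vs) (e # rev es)"
    using assms upath_rev[OF assms(1)] upath_neq_Nil[OF assms(1)]
    by (auto simp: upath_Cons hd_rev insert_commute)
  from upath_rev[OF this] show ?thesis by simp
qed

text \<open>Sum of the two initial segments ending at \<open>u\<close> and at \<open>v\<close>;
  whichever comes first, the common part cancels.\<close>

lemma upath_odd_at_segment:
  assumes "upath \<phi> vs es" "u \<in> set vs" "v \<in> set vs"
  shows "\<exists>Y\<subseteq>set es. \<forall>w. odd_at \<phi> Y w \<longleftrightarrow> (w = u) \<noteq> (w = v)"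
proof -
  have len: "length vs = Suc (length es)" using assms(1) by (simp add: upath_def)
  have prefix: "odd_at \<phi> (set (take i es)) w \<longleftrightarrow> (w = hd vs) \<noteq> (w = vs ! i)"
    if "i < length vs" for i w
  proof -
    have "last (take (Suc i) vs) = vs ! i"
      using that by (simp add: take_Suc_conv_app_nth)
    moreover have "hd (take (Suc i) vs) = hd vs" by simp
    ultimately show ?thesis
      using upath_odd_at[OF upath_take[OF assms(1), of i], of w] that len by simp
  qed
  obtain i j where ij: "i < length vs" "vs ! i = u" "j < length vs" "vs ! j = v"
    using assms(2,3) by (auto simp: in_set_conv_nth)
  let ?Y = "sym_diff (set (take i es)) (set (take j es))"
  have "?Y \<subseteq> set es" using set_take_subset[of i es] set_take_subset[of j es] by auto
  moreover have "odd_at \<phi> ?Y w \<longleftrightarrow> (w = u) \<noteq> (w = v)" for w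
    using prefix ij by (subst odd_at_sym_diff) auto
  ultimately show ?thesis by blast
qed

text \<open>Modulo 2 the end pair of \<open>e\<close> is the sum of the other two. It has two
  elements only if those share exactly one vertex, which is named \<open>a\<close>.\<close>

lemma even_triangle:
  assumes even: "even_set \<phi> {e, f, g}" and dist: "distinct [e, f, g]"
    and two: "card (\<phi> e) = 2" "card (\<phi> f) = 2" "card (\<phi> g) = 2"
  obtains a b p where "\<phi> g = {a, b}" "\<phi> f = {a, p}" "\<phi> e = {b, p}" "distinct [a, b, p]"
proof -
  have e: "v \<in> \<phi> e \<longleftrightarrow> (v \<in> \<phi> f) \<noteq> (v \<in> \<phi> g)" for v
    using even dist odd_at_insert[of "{f, g}" e \<phi> v] odd_at_insert[of "{g}" f \<phi> v]
      odd_at_insert[of "{}" g \<phi> v] by (auto simp: even_set_def)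
  obtain a b where ab: "\<phi> g = {a, b}" "a \<noteq> b" using two(3) by (auto simp: card_2_iff)
  obtain u v where uv: "\<phi> f = {u, v}" "u \<noteq> v" using two(2) by (auto simp: card_2_iff)
  have \<phi>e: "\<phi> e = sym_diff {u, v} {a, b}" using e ab uv by blast
  have "{u, v} \<inter> {a, b} \<noteq> {}"
  proof
    assume disj: "{u, v} \<inter> {a, b} = {}"
    then have "\<phi> e = {u, v, a, b}" using \<phi>e by blast
    moreover have "distinct [u, v, a, b]" using disj ab(2) uv(2) by auto
    ultimately show False using two(1) distinct_card[of "[u, v, a, b]"] by simp
  qed
  moreover have "{u, v} \<noteq> {a, b}"
  proof
    assume "{u, v} = {a, b}"
    then have "\<phi> e = {}" using \<phi>e by blast
    then show False using two(1) by simp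
  qed
  ultimately consider "u = a" "v \<noteq> b" | "u = b" "v \<noteq> a" | "v = a" "u \<noteq> b" | "v = b" "u \<noteq> a"
    by blast
  then show ?thesis
  proof cases
    case 1
    then show ?thesis using ab uv e that[of a b v] by auto
  next
    case 2
    then show ?thesis using ab uv e that[of b a v] by (auto simp: insert_commute)
  next
    case 3
    then show ?thesis using ab uv e that[of a b u] by (auto simp: insert_commute)
  next
    case 4
    then show ?thesis using ab uv e that[of b a u] by (auto simp: insert_commute)
  qed
qed

text \<open>A chord splits the cycle \<open>X\<close> into two even sets that are too small to become independent
  in \<open>F\<close>; their sum would make \<open>X\<close> dependent in \<open>F\<close>.\<close>

lemma no_chord:
  assumes G: "graph G" "no_parallel_edges G" and F: "graph F" and E: "edges F = edges G"
    and agree: "\<And>I. I \<subseteq> edges G \<Longrightarrow> card I < card X \<Longrightarrow>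
      acyclic_set (ends G) I \<longleftrightarrow> acyclic_set (ends F) I"
    and X: "X \<subseteq> edges G" "is_cycle (edge_induced G X)" "graph (edge_induced G X)"
    and acX: "acyclic_set (ends F) X"
    and e: "e \<in> edges G" "e \<notin> X" "ends G e \<subseteq> verts (edge_induced G X)"
  shows False
proof -
  let ?Q = "edge_induced G X"
  have Q: "ends ?Q = ends G" "edges ?Q = X" by (auto simp: edge_induced_def)
  have fin: "finite (edges G)" using G(1) by (simp add: graph_def)
  have finX: "finite X" using X(1) fin by (rule finite_subset)
  have two: "\<forall>f\<in>edges G. card (ends G f) = 2" using G(1) by (simp add: graph_def)
  have evX: "even_set (ends G) X" "X \<noteq> {}"
    using is_cycle_even_set[OF X(2,3)] Q by auto
  obtain u v where uv: "ends G e = {u, v}" "u \<noteq> v" using two e(1) by (auto simp: card_2_iff)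
  obtain x where x: "x \<in> X" using evX(2) by blast
  obtain p q where pq: "ends G x = {p, q}" using two X(1) x by (meson card_2_iff subsetD)
  obtain vs es where path: "upath (ends G) vs es" "set vs = verts ?Q" "set es = X - {x}"
    using is_cycle_remove_edge[OF X(2), of x p q] x pq unfolding Q by metis
  have "u \<in> set vs" "v \<in> set vs" using uv(1) e(3) path(2) by auto
  \<comment> \<open>\<open>X1\<close> is one arc of the cycle between the ends of the chord,
    \<open>X2\<close> will be the other.\<close>
  from upath_odd_at_segment[OF path(1) this]
  obtain X1 where "X1 \<subseteq> set es" and X1_odd: "\<forall>w. odd_at (ends G) X1 w \<longleftrightarrow> (w = u) \<noteq> (w = v)"
    by (elim exE conjE)
  then have X1: "X1 \<subseteq> X" "\<And>w. odd_at (ends G) X1 w \<longleftrightarrow> (w = u) \<noteq> (w = v)"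
    using path(3) by auto
  define X2 where "X2 = X - X1"
  have finX1: "finite X1" using X1(1) finX by (rule finite_subset)
  have ev1: "even_set (ends G) (insert e X1)"
    by (rule even_set_insertI[where u = u and v = v]) (use finX1 X1 e(2) uv in auto)
  moreover have "sym_diff (insert e X1) X = insert e X2"
    using X1(1) e(2) by (auto simp: X2_def)
  ultimately have ev2: "even_set (ends G) (insert e X2)"
    using even_set_sym_diff[of "insert e X1" X "ends G"] finX finX1 evX(1) by simp
  have finX2: "finite X2" using finX by (simp add: X2_def)
  have sub: "insert e X1 \<subseteq> edges G" "insert e X2 \<subseteq> edges G"
    using X(1) X1(1) e(1) by (auto simp: X2_def)
  have ge3: "3 \<le> card (insert e Y)"
    if "finite Y" "insert e Y \<subseteq> edges G" "even_set (ends G) (insert e Y)" for Y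
  proof (rule even_set_card_ge_3)
    show "inj_on (ends G) (insert e Y)"
      using G(2) that(2) unfolding no_parallel_edges_def by (rule inj_on_subset)
  qed (use that two in auto)
  \<comment> \<open>Without parallel edges both arcs have at least two edges, so each arc together
    with the chord is smaller than \<open>X\<close>.\<close>
  have "3 \<le> card (insert e X1)" "3 \<le> card (insert e X2)"
    using ge3 finX1 finX2 sub ev1 ev2 by auto
  moreover have "e \<notin> X1" "e \<notin> X2" using e(2) X1(1) by (auto simp: X2_def)
  moreover have "card X = card X1 + card X2"
    using X1(1) finX finX1 by (simp add: X2_def card_Diff_subset card_mono)
  ultimately have small: "card (insert e X1) < card X" "card (insert e X2) < card X"
    using finX1 finX2 by auto
  have "\<not> acyclic_set (ends G) (insert e X1)" "\<not> acyclic_set (ends G) (insert e X2)"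
    using ev1 ev2 by (auto simp: acyclic_set_def)
  then have "\<not> acyclic_set (ends F) (insert e X1)" "\<not> acyclic_set (ends F) (insert e X2)"
    using agree sub small by auto
  then obtain C1 C2 where C: "C1 \<subseteq> insert e X1" "even_set (ends F) C1" "C1 \<noteq> {}"
      "C2 \<subseteq> insert e X2" "even_set (ends F) C2" "C2 \<noteq> {}"
    unfolding acyclic_set_def by metis
  \<comment> \<open>An even set avoiding \<open>e\<close> would lie in \<open>X\<close>, which is
    independent in \<open>F\<close>.\<close>
  have "e \<in> C1" "e \<in> C2"
  proof -
    have "\<not> C1 \<subseteq> X" "\<not> C2 \<subseteq> X"
      using acX C(2,3,5,6) unfolding acyclic_set_def by metis+
    then show "e \<in> C1" "e \<in> C2" using C(1,4) X1(1) by (auto simp: X2_def)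
  qed
  then have "sym_diff C1 C2 \<subseteq> X"
    using C(1,4) X1(1) by (auto simp: X2_def)
  moreover have "finite C1" "finite C2"
    using finite_subset[OF C(1)] finite_subset[OF C(4)] finX1 finX2 by simp_all
  then have "even_set (ends F) (sym_diff C1 C2)"
    using even_set_sym_diff C(2,5) by metis
  ultimately have "sym_diff C1 C2 = {}"
    using acX unfolding acyclic_set_def by metis
  \<comment> \<open>\<open>C1\<close> and \<open>C2\<close> coincide, yet they can share only
    \<open>e\<close>, because the arcs are disjoint.\<close>
  then have "C1 = {e}"
    using C(1,4) \<open>e \<in> C1\<close> by (auto simp: X2_def)
  moreover have "card (ends F e) = 2" using F e(1) E by (simp add: graph_def)
  ultimately show False
    using even_set_card_ge_3[of C1 "ends F"] C(2) by auto
qed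

text \<open>The hub \<open>c\<close> and the middle vertex \<open>r\<close> serve as
  \<open>a\<close> and \<open>b\<close>. Removing \<open>r\<close> from the cycle leaves the path
  from \<open>r1\<close> to \<open>r2\<close> whose edges are those of \<open>X\<close> other than
  \<open>x1\<close> and \<open>x2\<close>.\<close>

lemma path_K4_of_cycle_with_three_spokes:
  assumes G: "graph G" and X: "is_cycle (edge_induced G X)"
    and q: "q \<in> verts G" "verts (edge_induced G X) = verts G - {q}"
    and c: "c \<in> verts G" "c \<notin> verts (edge_induced G X)"
    and E: "edges G = X \<union> {s1, s2, s}" and sX: "{s1, s2, s} \<inter> X = {}"
    and dist: "distinct [s1, s2, s]"
    and spokes: "ends G s1 = {c, r1}" "ends G s2 = {c, r2}" "ends G s = {c, r}"
    and dr: "distinct [r1, r, r2]"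
    and x: "x1 \<in> X" "x2 \<in> X" "ends G x1 = {r1, r}" "ends G x2 = {r, r2}"
  obtains ws L where "path_K4 G c r ws L s1 x1 x2 s2 s" "set L = X - {x1, x2}"
proof -
  let ?Q = "edge_induced G X"
  have Q: "ends ?Q = ends G" "edges ?Q = X" by (auto simp: edge_induced_def)
  have "q = c" using q c by auto
  have "x1 \<noteq> x2" using x(3,4) dr by (auto simp: doubleton_eq_iff)
  \<comment> \<open>Deleting \<open>x2\<close> opens the cycle at \<open>r\<close>; the resulting
    path starts with \<open>x1\<close>.\<close>
  obtain vs es where p: "upath (ends G) vs es" "hd vs = r" "last vs = r2" "set vs = verts ?Q"
    "set es = X - {x2}"
    using is_cycle_remove_edge[OF X, of x2 r r2] Q x by auto
  have "x1 \<in> set es" using p(5) x \<open>x1 \<noteq> x2\<close> by auto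
  then obtain e L where es: "es = e # L" by (cases es) auto
  have "x1 = e"
    using upath_hd_edge[of "ends G" vs e L x1] p(1,2) es \<open>x1 \<in> set es\<close> x(3) by auto
  then obtain ws where ws: "vs = r # ws" "r \<notin> set ws" "ends G x1 = {r, hd ws}" "upath (ends G) ws L"
    using p(1,2) es by (auto simp: upath_Cons)
  have ne: "ws \<noteq> []" using ws(4) by (rule upath_neq_Nil)
  have "hd ws = r1" using ws(3) x(3) dr by (auto simp: doubleton_eq_iff)
  have "last ws = r2" using p(3) ws(1) ne by simp
  have dL: "distinct L" "x1 \<notin> set L"
    using upath_distinct_edges[OF p(1)] es \<open>x1 = e\<close> by auto
  have L: "set L = X - {x1, x2}" using p(5) es \<open>x1 = e\<close> dL by auto
  have "c \<notin> set vs" "verts G = insert c (set vs)" using p(4) c q \<open>q = c\<close> by auto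
  moreover have "edges G = {s1, x1, x2, s2, s} \<union> set L" using E L x by auto
  moreover have "distinct ([s1, x1, x2, s2, s] @ L)"
    using L dL sX dist x \<open>x1 \<noteq> x2\<close> by auto
  ultimately have "path_K4 G c r ws L s1 x1 x2 s2 s"
    using ws spokes x \<open>hd ws = r1\<close> \<open>last ws = r2\<close> by (auto simp: path_K4_def insert_commute)
  then show ?thesis using L that by blast
qed

text \<open>In \<open>F\<close>, every fundamental cycle over \<open>X\<close> other than \<open>X \<union> {s}\<close> yields, modulo the two
  triangles, a small even set that is independent in \<open>G\<close>.\<close>

lemma path_K4_hamiltonian_even_set:
  assumes G: "path_K4 G c r ws L s1 x1 x2 s2 s" and X: "X = set L \<union> {x1, x2}"
    and F: "graph F" and E: "edges F = edges G"
    and agree: "\<And>I. I \<subseteq> edges G \<Longrightarrow> card I < card X \<Longrightarrow>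
      acyclic_set (ends G) I \<longleftrightarrow> acyclic_set (ends F) I"
    and t1: "even_set (ends F) {s1, x1, s}" and t2: "even_set (ends F) {s2, x2, s}"
    and conn: "graph_connected (edge_induced F X)" "graph (edge_induced F X)"
    and span: "verts (edge_induced F X) = verts F"
  shows "even_set (ends F) (insert s X)"
proof -
  have dist: "distinct ([s1, x1, x2, s2, s] @ L)"
    and EG: "edges G = {s1, x1, x2, s2, s} \<union> set L" using G by (auto simp: path_K4_def)
  let ?H = "edge_induced F X"
  have H: "ends ?H = ends F" "edges ?H = X" by (auto simp: edge_induced_def)
  have finX: "finite X" using X by simp
  have cX: "card X = card (set L) + 2" using X dist by auto
  have "s \<in> edges F" using E EG by simp
  then obtain a b where ab: "ends F s = {a, b}" "a \<noteq> b" "a \<in> verts F" "b \<in> verts F"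
    using F by (fastforce simp: graph_def card_2_iff)
  then have "(adjacent ?H)\<^sup>*\<^sup>* a b"
    using conn(1) span by (auto simp: graph_connected_def)
  \<comment> \<open>\<open>Y\<close> joins the ends of \<open>s\<close> inside \<open>F[X]\<close>,
    so that \<open>insert s Y\<close> is even; the aim is \<open>Y = X\<close>.\<close>
  then obtain Y where Y: "Y \<subseteq> X" "\<And>w. odd_at (ends F) Y w \<longleftrightarrow> (w = a) \<noteq> (w = b)"
    using odd_at_walk[of ?H a b] conn(2) finX H by auto
  have finY: "finite Y" using Y(1) finX by (rule finite_subset)
  have "s \<notin> Y" using Y(1) X dist by auto
  have evY: "even_set (ends F) (insert s Y)"
    by (rule even_set_insertI[where u = a and v = b]) (use finY \<open>s \<notin> Y\<close> Y(2) ab in auto)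
  have no_small: False
    if "even_set (ends F) D" "D \<noteq> {}" "D \<subseteq> A" "acyclic_set (ends G) A" "D \<subseteq> edges G"
      "card D < card X" for D A
  proof -
    have "acyclic_set (ends F) D"
      using agree[OF that(5,6)] acyclic_set_subset[OF that(4,3)] by simp
    then show False using that(1,2) by (auto simp: acyclic_set_def)
  qed
  \<comment> \<open>Three paths of \<open>G\<close> supply independent sets that contain the small
    even sets arising below.\<close>
  have path: "upath (ends G) ws L" using G by (simp add: path_K4_def)
  have last: "last (c # ws) = last ws" using upath_neq_Nil[OF path] by simp
  have "upath (ends G) (c # ws) (s1 # L)"
    using path G by (auto simp: path_K4_def upath_Cons insert_commute)
  then have "upath (ends G) ((c # ws) @ [r]) ((s1 # L) @ [x2])"
    by (rule upath_snoc) (use G last in \<open>auto simp: path_K4_def\<close>)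
  then have ac1: "acyclic_set (ends G) ({s1, x2} \<union> set L)"
    using upath_acyclic by fastforce
  have "upath (ends G) (ws @ [c]) (L @ [s2])"
    by (rule upath_snoc) (use path G in \<open>auto simp: path_K4_def\<close>)
  then have ac2: "acyclic_set (ends G) (insert s2 (set L))"
    using upath_acyclic by fastforce
  have "upath (ends G) (c # r # ws) (s # x1 # L)"
    using path G by (auto simp: path_K4_def upath_Cons insert_commute)
  then have ac3: "acyclic_set (ends G) (insert s (insert x1 (set L)))"
    using upath_acyclic by fastforce
  define P where "P = Y \<inter> set L"
  have P: "P \<subseteq> set L" "finite P" by (auto simp: P_def)
  have cP: "card P \<le> card (set L)" using P by (simp add: card_mono)
  have ev1: "even_set (ends F) (sym_diff (insert s Y) {s1, x1, s})"
    and ev2: "even_set (ends F) (sym_diff (insert s Y) {s2, x2, s})"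
    using even_set_sym_diff[OF _ _ evY t1] even_set_sym_diff[OF _ _ evY t2] finY by auto
  have "Y = X"
  proof (rule ccontr)
    assume "Y \<noteq> X"
    consider "x1 \<in> Y" "x2 \<in> Y" | "x1 \<in> Y" "x2 \<notin> Y" | "x1 \<notin> Y" "x2 \<in> Y" | "x1 \<notin> Y" "x2 \<notin> Y"
      by blast
    then show False
    proof cases
      case 1
      \<comment> \<open>The triangle trades \<open>s\<close> and \<open>x1\<close> for
        \<open>s1\<close>. The result has fewer than \<open>card X\<close> edges unless
        \<open>P\<close> is all of \<open>set L\<close>, that is, unless
        \<open>Y = X\<close>.\<close>
      have "sym_diff (insert s Y) {s1, x1, s} = {s1, x2} \<union> P"
        using 1 Y(1) X dist by (auto simp: P_def)
      moreover have "P \<noteq> set L" using 1 Y(1) X \<open>Y \<noteq> X\<close> by (auto simp: P_def)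
      then have "card P < card (set L)" using P by (simp add: psubset_card_mono psubsetI)
      then have "card ({s1, x2} \<union> P) < card X"
        using cX card_Un_le[of "{s1, x2}" P] dist by simp
      ultimately show False
        using no_small[of "{s1, x2} \<union> P", OF _ _ _ ac1] ev1 P EG by auto
    next
      case 2
      have "sym_diff (insert s Y) {s1, x1, s} = insert s1 P"
        using 2 Y(1) X dist by (auto simp: P_def)
      moreover have "card (insert s1 P) < card X"
        using cX card_insert_le_m1[of "Suc (card P)" P s1] cP by simp
      ultimately show False
        using no_small[of "insert s1 P", OF _ _ _ ac1] ev1 P EG by auto
    next
      case 3
      have "sym_diff (insert s Y) {s2, x2, s} = insert s2 P"
        using 3 Y(1) X dist by (auto simp: P_def)
      moreover have "card (insert s2 P) < card X"
        using cX card_insert_le_m1[of "Suc (card P)" P s2] cP by simp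
      ultimately show False
        using no_small[of "insert s2 P", OF _ _ _ ac2] ev2 P EG by auto
    next
      case 4
      \<comment> \<open>Here \<open>insert s Y\<close> is itself small enough.\<close>
      have "insert s Y = insert s P"
        using 4 Y(1) X by (auto simp: P_def)
      moreover have "card (insert s P) < card X"
        using cX card_insert_le_m1[of "Suc (card P)" P s] cP by simp
      ultimately show False
        using no_small[of "insert s P", OF _ _ _ ac3] evY P EG by auto
    qed
  qed
  then show ?thesis using evY by simp
qed

text \<open>An even set made of the independent set \<open>X\<close> and one more edge is a single
  cycle, here a Hamiltonian one. Opened at \<open>s\<close> it is a path whose end edges are
  \<open>x1\<close> and \<open>x2\<close>, by the two triangles; what lies between them is the
  subdivided edge.\<close>

lemma path_K4_of_hamiltonian_even_set:
  assumes F: "graph F" and E: "edges F = insert s X \<union> {s1, s2}"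
    and dist: "distinct [s1, x1, x2, s2, s]" and nX: "s1 \<notin> X" "s2 \<notin> X" "s \<notin> X"
    and x: "x1 \<in> X" "x2 \<in> X"
    and acX: "acyclic_set (ends F) X" and ev: "even_set (ends F) (insert s X)"
    and span: "verts (edge_induced F X) = verts F"
    and t1: "even_set (ends F) {s1, x1, s}" and t2: "even_set (ends F) {s2, x2, s}"
  obtains a b us L where "path_K4 F a b us L x1 s1 x2 s2 s" "set L = X - {x1, x2}"
proof -
  let ?C = "insert s X"
  have CE: "?C \<subseteq> edges F" using E by auto
  have fin: "finite (edges F)" using F by (simp add: graph_def)
  have finC: "finite ?C" using CE fin by (rule finite_subset)
  have two: "card (ends F e) = 2" if "e \<in> edges F" for e using F that by (simp add: graph_def)
  have "\<not> acyclic_set (ends F) ?C" using ev by (auto simp: acyclic_set_def)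
  then obtain Q where Q: "subgraph Q (edge_induced F ?C)" "is_cycle Q"
    using is_forest_iff[OF F CE] by (auto simp: is_forest_def)
  have Qs: "graph Q" "edges Q \<subseteq> ?C" "\<And>e. e \<in> edges Q \<Longrightarrow> ends Q e = ends F e"
    "verts Q \<subseteq> verts (edge_induced F ?C)"
    using Q(1) by (auto simp: subgraph_def edge_induced_def)
  moreover have "verts (edge_induced F ?C) \<subseteq> verts F"
    using F CE unfolding edge_induced_def graph_def by auto
  ultimately have vQ: "verts Q \<subseteq> verts F" by blast
  have evQ: "even_set (ends F) (edges Q)" "edges Q \<noteq> {}"
    using is_cycle_even_set[OF Q(2) Qs(1)] even_set_cong[of "edges Q" "ends Q" "ends F"] Qs(3)
    by blast+
  have "s \<in> edges Q"
  proof (rule ccontr)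
    assume "s \<notin> edges Q"
    then have "edges Q \<subseteq> X" using Qs(2) by blast
    then show False using acX evQ by (auto simp: acyclic_set_def)
  qed
  \<comment> \<open>The part of \<open>insert s X\<close> outside the cycle \<open>Q\<close> is an
    even subset of \<open>X\<close>, hence empty.\<close>
  have "even_set (ends F) (sym_diff ?C (edges Q))"
    using even_set_sym_diff[OF finC _ ev evQ(1)] finite_subset[OF Qs(2) finC] by blast
  moreover have "sym_diff ?C (edges Q) \<subseteq> X" using Qs(2) \<open>s \<in> edges Q\<close> by blast
  ultimately have "sym_diff ?C (edges Q) = {}"
    using acX unfolding acyclic_set_def by metis
  then have eQ: "edges Q = ?C" by blast
  \<comment> \<open>This names \<open>a\<close> as the end of \<open>s\<close> on \<open>x1\<close>;
    the second triangle is fitted to this choice below.\<close>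
  obtain a b p where t: "ends F s = {a, b}" "ends F x1 = {a, p}" "ends F s1 = {b, p}"
    "distinct [a, b, p]"
    using even_triangle[OF t1] two dist E x by auto
  have sQ: "ends Q s = {a, b}" using Qs(3)[OF \<open>s \<in> edges Q\<close>] t(1) by simp
  obtain vs es where path': "upath (ends Q) vs es" and vs: "hd vs = a" "last vs = b"
    "set vs = verts Q" and es: "set es = X"
    using is_cycle_remove_edge[OF Q(2) \<open>s \<in> edges Q\<close> sQ] eQ nX(3) by (metis Diff_insert_absorb)
  have path: "upath (ends F) vs es"
    using path' upath_cong[of es "ends Q" "ends F" vs] Qs(3) es eQ by auto
  have vF: "set vs = verts F"
  proof
    have "(\<Union>e\<in>X. ends F e) \<subseteq> set vs"
      using upath_edge_subset[OF path] unfolding es by blast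
    then show "verts F \<subseteq> set vs" using span by (simp add: edge_induced_def)
  qed (use vs vQ in simp)
  obtain e L1 where e: "es = e # L1" using es x by (cases es) auto
  have "x1 = e"
    by (rule upath_hd_edge[of "ends F" vs e L1]) (use path e es x vs t in auto)
  with e have es1: "es = x1 # L1" by simp
  then obtain vs1 where vs1: "vs = a # vs1" "a \<notin> set vs1" "ends F x1 = {a, hd vs1}"
    "upath (ends F) vs1 L1"
    using path vs(1) by (auto simp: upath_Cons)
  have "hd vs1 = p" using vs1(3) t by (auto simp: doubleton_eq_iff)
  have "x2 \<in> set L1" using x es es1 dist by auto
  have "x2 \<noteq> x1" using dist by auto
  \<comment> \<open>Only the first edge of the path meets \<open>a\<close>, so the second triangle
    must attach \<open>x2\<close> to \<open>b\<close>.\<close>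
  have "a \<notin> ends F x2"
    using upath_edge_subset[OF vs1(4) \<open>x2 \<in> set L1\<close>] vs1(2) by blast
  moreover obtain a' b' q where t': "ends F s = {b', a'}" "ends F x2 = {b', q}"
    "ends F s2 = {a', q}" "distinct [b', a', q]"
    using even_triangle[OF t2] two dist E x by auto
  ultimately have "b' = b" "a' = a" using t(1) by (auto simp: doubleton_eq_iff)
  \<comment> \<open>Reversing brings \<open>x2\<close> to the front, where it is split off just as
    \<open>x1\<close> was.\<close>
  have rpath: "upath (ends F) (rev vs1) (rev L1)" using vs1(4) by (rule upath_rev)
  have ne1: "vs1 \<noteq> []" using vs1(4) by (rule upath_neq_Nil)
  have "last vs1 = b" using vs(2) vs1(1) ne1 by simp
  then have hdr: "hd (rev vs1) = b" using ne1 by (simp add: hd_rev)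
  obtain f L2 where f: "rev L1 = f # L2" using \<open>x2 \<in> set L1\<close> by (cases "rev L1") auto
  have "x2 = f"
  proof (rule upath_hd_edge[of "ends F" "rev vs1" f L2])
    show "x2 \<in> set (f # L2)" using \<open>x2 \<in> set L1\<close> f by (metis set_rev)
    show "hd (rev vs1) \<in> ends F x2" using hdr t'(2) \<open>b' = b\<close> by simp
  qed (use rpath f in simp)
  then obtain us where us: "rev vs1 = b # us" "b \<notin> set us" "ends F x2 = {b, hd us}"
    "upath (ends F) us L2"
    using rpath f hdr by (auto simp: upath_Cons)
  have "hd us = q" using us(3) t' \<open>b' = b\<close> by (auto simp: doubleton_eq_iff)
  have neu: "us \<noteq> []" using us(4) by (rule upath_neq_Nil)
  have vs1_eq: "vs1 = rev us @ [b]" using us(1) by (metis rev.simps(2) rev_rev_ident)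
  have L1_eq: "L1 = rev L2 @ [x2]" using f \<open>x2 = f\<close> by (metis rev.simps(2) rev_rev_ident)
  have hl: "hd (rev us) = p" "last (rev us) = q"
    using \<open>hd vs1 = p\<close> \<open>hd us = q\<close> neu by (auto simp: vs1_eq last_rev)
  have "distinct es" using path by (rule upath_distinct_edges)
  then have L2: "set (rev L2) = X - {x1, x2}" "distinct (rev L2)"
    using es unfolding es1 L1_eq by auto
  have "upath (ends F) (rev us) (rev L2)" using us(4) by (rule upath_rev)
  moreover have "verts F = insert a (insert b (set (rev us)))"
    using vF vs1(1) vs1_eq by auto
  moreover have "a \<notin> set (rev us)" "b \<notin> set (rev us)" "a \<noteq> b"
    using vs1(2) us(2) by (auto simp: vs1_eq)
  moreover have "edges F = {x1, s1, x2, s2, s} \<union> set (rev L2)" using E L2(1) x by auto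
  moreover have "distinct ([x1, s1, x2, s2, s] @ rev L2)"
    using L2 dist nX by auto
  ultimately have "path_K4 F a b (rev us) (rev L2) x1 s1 x2 s2 s"
    unfolding path_K4_def hl
    using t t' \<open>b' = b\<close> \<open>a' = a\<close> by (auto simp: insert_commute)
  then show ?thesis using L2(1) that by blast
qed

section \<open>Complete graphs, for the case of four vertices\<close>

lemma complete_ends_image:
  assumes G: "graph G" "no_parallel_edges G" and c: "card (edges G) = card (verts G) choose 2"
  shows "ends G ` edges G = {S. S \<subseteq> verts G \<and> card S = 2}"
proof (rule card_subset_eq)
  show "finite {S. S \<subseteq> verts G \<and> card S = 2}" using G(1) by (simp add: graph_def)
  show "ends G ` edges G \<subseteq> {S. S \<subseteq> verts G \<and> card S = 2}" using G(1) by (auto simp: graph_def)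
  show "card (ends G ` edges G) = card {S. S \<subseteq> verts G \<and> card S = 2}"
    using G c by (simp add: no_parallel_edges_def card_image n_subsets graph_def)
qed

text \<open>An edge is determined by its end pair and every pair occurs, so any bijection of the
  vertices carries the edges along.\<close>

lemma complete_graph_isomorphic:
  assumes G: "graph G" "no_parallel_edges G" "card (edges G) = card (verts G) choose 2"
    and F: "graph F" "no_parallel_edges F" "card (edges F) = card (verts F) choose 2"
    and "card (verts G) = card (verts F)"
  shows "graph_isomorphic G F"
proof -
  have finv: "finite (verts G)" "finite (verts F)" using G(1) F(1) by (auto simp: graph_def)
  then obtain f where f: "bij_betw f (verts G) (verts F)"
    using finite_same_card_bij assms(7) by blast
  have bG: "bij_betw (ends G) (edges G) {S. S \<subseteq> verts G \<and> card S = 2}"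
    using complete_ends_image[OF G] G(2) by (simp add: bij_betw_def no_parallel_edges_def)
  have bF: "bij_betw (ends F) (edges F) {S. S \<subseteq> verts F \<and> card S = 2}"
    using complete_ends_image[OF F] F(2) by (simp add: bij_betw_def no_parallel_edges_def)
  let ?i = "inv_into (edges F) (ends F)"
  have inj: "inj_on f (verts G)" and im: "f ` verts G = verts F"
    using f by (auto simp: bij_betw_def)
  have "bij_betw ((`) f) {S. S \<subseteq> verts G \<and> card S = 2} {S. S \<subseteq> verts F \<and> card S = 2}"
    unfolding bij_betw_def
  proof
    show "inj_on ((`) f) {S. S \<subseteq> verts G \<and> card S = 2}"
      using inj by (auto simp: inj_on_def inj_on_image_eq_iff)
    show "(`) f ` {S. S \<subseteq> verts G \<and> card S = 2} = {S. S \<subseteq> verts F \<and> card S = 2}"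
    proof (intro equalityI subsetI)
      fix T assume "T \<in> {S. S \<subseteq> verts F \<and> card S = 2}"
      then have "T \<subseteq> f ` verts G" "card T = 2" using im by auto
      then obtain S where S: "S \<subseteq> verts G" "T = f ` S" "card T = 2"
        by (meson subset_imageE)
      then have "card S = 2" using card_image[OF inj_on_subset[OF inj S(1)]] by simp
      then show "T \<in> (`) f ` {S. S \<subseteq> verts G \<and> card S = 2}" using S by auto
    next
      fix T assume "T \<in> (`) f ` {S. S \<subseteq> verts G \<and> card S = 2}"
      then obtain S where S: "S \<subseteq> verts G" "T = f ` S" "card S = 2" by auto
      then show "T \<in> {S. S \<subseteq> verts F \<and> card S = 2}"
        using card_image[OF inj_on_subset[OF inj S(1)]] im by auto
    qed
  qed
  from bij_betw_trans[OF bij_betw_trans[OF bG this] bij_betw_inv_into[OF bF]]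
  have "bij_betw (?i \<circ> ((`) f \<circ> ends G)) (edges G) (edges F)" .
  moreover have "ends F ((?i \<circ> ((`) f \<circ> ends G)) e) = f ` ends G e" if "e \<in> edges G" for e
  proof -
    have "ends G e \<subseteq> verts G" "card (ends G e) = 2" using G(1) that by (auto simp: graph_def)
    then have "f ` ends G e \<in> {S. S \<subseteq> verts F \<and> card S = 2}"
      using card_image[OF inj_on_subset[OF inj, of "ends G e"]] im by auto
    then show ?thesis using bF by (simp add: bij_betw_inv_into_right)
  qed
  ultimately show ?thesis using f unfolding graph_isomorphic_def by blast
qed

text \<open>Every ordering of the vertices is a Hamiltonian cycle.\<close>

lemma complete_two_connected:
  assumes G: "graph G" "no_parallel_edges G" "card (edges G) = card (verts G) choose 2"
    and "3 \<le> card (verts G)"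
  shows "two_connected G"
proof -
  have "finite (verts G)" using G(1) by (simp add: graph_def)
  then obtain vs where vs: "set vs = verts G" "distinct vs"
    using finite_distinct_list by blast
  then have len: "3 \<le> length vs" using assms(4) by (metis distinct_card)
  show ?thesis
  proof (rule two_connected_if_hamiltonian_cycle)
    fix i assume i: "i < length vs"
    have j: "Suc i mod length vs < length vs" using i by (intro mod_less_divisor) linarith
    have "Suc i mod length vs \<noteq> i"
      using i len by (cases "Suc i = length vs") auto
    then have "vs ! i \<noteq> vs ! (Suc i mod length vs)"
      using i j vs(2) by (simp add: nth_eq_iff_index_eq)
    then have "{vs ! i, vs ! (Suc i mod length vs)} \<in> ends G ` edges G"
      using complete_ends_image[OF G] vs(1) i j by auto
    then show "adjacent G (vs ! i) (vs ! (Suc i mod length vs))"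
      by (auto simp: adjacent_def)
  qed (use vs len in auto)
qed

text \<open>The description by switches and an exchange excludes four vertices. There
  \<open>G\<close> is \<open>K4\<close> and the truncation is uniform of rank two, so
  \<open>F\<close> may be any labelling of \<open>K4\<close> in which \<open>X\<close> is a spanning
  tree, for instance a star. Switches fix \<open>K4\<close> up to the names of vertices and either
  exchange turns the triangle \<open>X\<close> into a path, so a star is out of reach.\<close>

theorem claim3p11:
  fixes G :: "('v, 'e) mgraph" and F :: "('w, 'e) mgraph"
    and E X :: "'e set" and c r1 r r2 :: 'v and s1 s s2 x1 x2 :: 'e
  assumes "graph G" and "graph_connected G" and "no_parallel_edges G"
    and "graph F" and "graph_connected F" and "no_parallel_edges F"
    and "edges G = E" and "edges F = E"
    and "truncated_cycle_matroid G = truncated_cycle_matroid F"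
    and "cycle_matroid G \<noteq> cycle_matroid F"
    and "X \<subseteq> E"
    and "quasi_hamiltonian_cycle G (edge_induced G X)"
    and "spanning_tree F (edge_induced F X)"
    and "c \<in> verts G" and "c \<notin> verts (edge_induced G X)"
    and "spokes G c = {s1, s2, s}" and "distinct [s1, s2, s]"
    and "ends G s1 = {c, r1}" and "ends G s2 = {c, r2}" and "ends G s = {c, r}"
    and "distinct [r1, r, r2]"
    and "x1 \<in> X" and "x2 \<in> X" and "ends G x1 = {r1, r}" and "ends G x2 = {r, r2}"
  shows "graph_isomorphic G F \<and>
    (card (verts G) \<noteq> 4 \<longrightarrow>
      (\<exists>H. switches_and_exchange {(x1, s1), (x2, s2)} G H \<and> equal_up_to_vertex_names H F)) \<and>
    two_connected G \<and> two_connected F"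
proof -
  note G = \<open>graph G\<close> and F = \<open>graph F\<close>
  have EF: "edges F = edges G" using assms(7,8) by simp
  have XE: "X \<subseteq> edges G" "X \<subseteq> edges F" using assms(7,8,11) by auto
  have cyc: "subgraph (edge_induced G X) G" "is_cycle (edge_induced G X)"
    using assms(12) by (auto simp: quasi_hamiltonian_cycle_def)
  obtain q where q: "q \<in> verts G" "verts (edge_induced G X) = verts G - {q}"
    using assms(12) by (auto simp: quasi_hamiltonian_cycle_def)
  then have "q = c" using assms(14,15) by auto
  have tree: "subgraph (edge_induced F X) F" "graph_connected (edge_induced F X)"
    "is_forest (edge_induced F X)" "verts (edge_induced F X) = verts F"
    using assms(13) by (auto simp: spanning_tree_def is_tree_def)
  have gr: "graph (edge_induced G X)" "graph (edge_induced F X)"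
    using cyc(1) tree(1) by (auto simp: subgraph_def)
  have acX: "acyclic_set (ends F) X" using is_forest_iff[OF F XE(2)] tree(3) by simp
  \<comment> \<open>\<open>F\<close> takes the first place in the comparison because
    \<open>X\<close> is independent there and supplies the rank bound.\<close>
  have agree: "acyclic_set (ends G) I \<longleftrightarrow> acyclic_set (ends F) I"
    if "I \<subseteq> edges G" "card I < card X" for I
    using acyclic_set_iff_truncation[OF F G EF assms(9)[symmetric] XE(2) acX] that EF by simp
  have sE: "{s1, s2, s} \<subseteq> edges G" using assms(16) by (auto simp: spokes_def)
  have sX: "{s1, s2, s} \<inter> X = {}"
  proof -
    have "\<forall>e\<in>X. c \<notin> ends G e" using assms(15) by (auto simp: edge_induced_def)
    then show ?thesis using assms(18-20) by auto
  qed
  \<comment> \<open>An edge that is not a spoke misses \<open>c\<close>, so outside \<open>X\<close>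
    it would be a chord.\<close>
  have EG: "edges G = X \<union> {s1, s2, s}"
  proof (rule ccontr)
    assume "edges G \<noteq> X \<union> {s1, s2, s}"
    then obtain e where e: "e \<in> edges G" "e \<notin> X" "e \<notin> {s1, s2, s}" using XE sE by blast
    then have "c \<notin> ends G e" using assms(16) by (auto simp: spokes_def)
    moreover have "ends G e \<subseteq> verts G" using G e(1) by (simp add: graph_def)
    ultimately have "ends G e \<subseteq> verts (edge_induced G X)" using q \<open>q = c\<close> by auto
    then show False
      using no_chord[OF G assms(3) F EF agree XE(1) cyc(2) gr(1) acX e(1,2)] by blast
  qed
  obtain ws L where KG: "path_K4 G c r ws L s1 x1 x2 s2 s" and L: "set L = X - {x1, x2}"
    using path_K4_of_cycle_with_three_spokes[OF G cyc(2) q assms(14,15) EG sX assms(17-25)] .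
  have dist: "distinct ([s1, x1, x2, s2, s] @ L)" using KG by (simp add: path_K4_def)
  have XL: "X = set L \<union> {x1, x2}" using L assms(22,23) by auto
  have "card X = Suc (Suc (card (set L)))" using XL dist by simp
  then have cX: "card X = Suc (Suc (length L))"
    using distinct_card[of L] dist by simp
  have "upath (ends G) ws L" using KG by (simp add: path_K4_def)
  then have "card (set ws) = Suc (length L)" by (simp add: upath_def distinct_card)
  then have cV: "card (verts G) = Suc (Suc (Suc (length L)))"
    using KG by (simp add: path_K4_def)
  have twoG: "two_connected G" using KG by (rule path_K4_two_connected)
  show ?thesis
  proof (cases "card (verts G) = 4")
    case True
    then have L1: "length L = 1" using cV by simp
    have "edges G = set ([s1, x1, x2, s2, s] @ L)" using KG by (auto simp: path_K4_def)
    then have cE: "card (edges G) = 6" using dist L1 distinct_card by fastforce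
    \<comment> \<open>The spanning tree \<open>F[X]\<close> has only three edges here; conversely,
      six distinct end pairs force at least four vertices.\<close>
    have "card (verts F) \<le> 4"
      using connected_card_verts_le[OF tree(2) _ gr(2)] gr(2) tree(4) cX L1
      by (simp add: edge_induced_def graph_def)
    moreover have "6 \<le> card (verts F) choose 2"
    proof -
      have "card (ends F ` edges F) = 6"
        using assms(6) EF cE by (simp add: card_image no_parallel_edges_def)
      moreover have "ends F ` edges F \<subseteq> {S. S \<subseteq> verts F \<and> card S = 2}"
        using F by (auto simp: graph_def)
      ultimately show ?thesis
        using F card_mono[of "{S. S \<subseteq> verts F \<and> card S = 2}" "ends F ` edges F"]
        by (simp add: n_subsets graph_def)
    qed
    moreover have "n choose 2 < 6" if "n < 4" for n :: nat
    proof -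
      have "n \<in> {0, 1, 2, 3}" using that by auto
      then show ?thesis by (auto simp: choose_two)
    qed
    ultimately have cF: "card (verts F) = 4"
      using leD linorder_neqE_nat by blast
    have "4 choose 2 = (6 :: nat)" by (simp add: choose_two)
    then have "card (edges G) = card (verts G) choose 2" "card (edges F) = card (verts F) choose 2"
      using True cF cE EF by simp_all
    then show ?thesis
      using True cF twoG complete_graph_isomorphic[OF G assms(3) _ F assms(6)]
        complete_two_connected[OF F assms(6)] by simp
  next
    case False
    \<comment> \<open>A path without edges would identify \<open>r1\<close> and
      \<open>r2\<close>.\<close>
    have "L \<noteq> []"
    proof
      assume "L = []"
      with \<open>upath (ends G) ws L\<close> obtain w where "ws = [w]" by auto
      then have "ends G x1 = {w, r}" "ends G x2 = {w, r}" using KG by (auto simp: path_K4_def)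
      then show False using assms(21,24,25) by (auto simp: doubleton_eq_iff)
    qed
    then have "4 \<le> card X" using False cV cX by (cases L; cases "tl L") auto
    \<comment> \<open>Three edges are fewer than \<open>card X\<close>, so a triangle of
      \<open>G\<close> is dependent in \<open>F\<close>. A nonempty even subset has at least three
      edges there, hence is the whole triangle.\<close>
    then have triangle: "even_set (ends F) {e, f, g}"
      if "distinct [e, f, g]" "{e, f, g} \<subseteq> edges G" "even_set (ends G) {e, f, g}" for e f g
    proof -
      have c3: "card {e, f, g} = 3" using that(1) by simp
      have "\<not> acyclic_set (ends G) {e, f, g}" using that(3) by (auto simp: acyclic_set_def)
      then have "\<not> acyclic_set (ends F) {e, f, g}"
        using agree[OF that(2)] c3 \<open>4 \<le> card X\<close> by simp
      then obtain C where C: "C \<subseteq> {e, f, g}" "even_set (ends F) C" "C \<noteq> {}"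
        unfolding acyclic_set_def by metis
      have "finite C" using C(1) by (rule finite_subset) simp
      moreover have "C \<subseteq> edges F" using C(1) that(2) EF by blast
      ultimately have "3 \<le> card C"
        using even_set_card_ge_3[OF _ C(2,3)] F assms(6) inj_on_subset
        unfolding graph_def no_parallel_edges_def by blast
      then have "C = {e, f, g}"
        using C(1) c3 card_seteq[of "{e, f, g}" C] by simp
      then show ?thesis using C(2) by simp
    qed
    have ev: "even_set (ends G) {e, f, g}"
      if "distinct [e, f, g]" "ends G e = {u, v}" "ends G f = {v, w}" "ends G g = {u, w}"
        "distinct [u, v, w]" for e f g u v w
      using that odd_at_insert[of "{f, g}" e "ends G"] odd_at_insert[of "{g}" f "ends G"]
        odd_at_insert[of "{}" g "ends G"] by (auto simp: even_set_def)
    have "r \<noteq> c" "r1 \<noteq> c" "r2 \<noteq> c"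
      using G sE assms(18-20) unfolding graph_def by force+
    then have "even_set (ends G) {s1, x1, s}" "even_set (ends G) {s2, x2, s}"
      using ev[of s1 x1 s c r1 r] ev[of s2 x2 s c r2 r] dist assms(18-25)
      by (auto simp: insert_commute)
    moreover have "{s1, x1, s} \<subseteq> edges G" "{s2, x2, s} \<subseteq> edges G"
      using sE XE(1) assms(22,23) by auto
    moreover have "distinct [s1, x1, s]" "distinct [s2, x2, s]" using dist by auto
    ultimately have t1: "even_set (ends F) {s1, x1, s}" and t2: "even_set (ends F) {s2, x2, s}"
      using triangle by blast+
    have evX: "even_set (ends F) (insert s X)"
      using path_K4_hamiltonian_even_set[OF KG XL F EF agree t1 t2 tree(2) gr(2) tree(4)] .
    have EF': "edges F = insert s X \<union> {s1, s2}" using EF EG by auto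
    have nX: "s1 \<notin> X" "s2 \<notin> X" "s \<notin> X" using sX by auto
    have "distinct [s1, x1, x2, s2, s]" using dist by simp
    from path_K4_of_hamiltonian_even_set
      [OF F EF' this nX assms(22,23) acX evX tree(4) t1 t2]
    obtain a b us L' where KF: "path_K4 F a b us L' x1 s1 x2 s2 s"
      and L': "set L' = X - {x1, x2}" .
    have dL': "distinct L'" using KF by (simp add: path_K4_def)
    have mset: "mset L = mset L'"
      using set_eq_iff_mset_eq_distinct[of L L'] dL' dist L L' by simp
    \<comment> \<open>Among the five named edges only \<open>x1\<close> and \<open>s1\<close> differ
      in role between \<open>KG\<close> and \<open>KF\<close>. Interchanging the names
      \<open>a\<close> and \<open>b\<close> in \<open>F\<close> would give the exchange of
      \<open>x2\<close> and \<open>s2\<close> instead.\<close>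
    have "path_K4 (exchange_edges x1 s1 G) c r ws ([] @ L) x1 s1 x2 s2 s"
      using path_K4_exchange_edges[OF KG] by simp
    from path_K4_permute[OF this mset] obtain H
      where H: "whitney_switch\<^sup>*\<^sup>* (exchange_edges x1 s1 G) H" "path_K4 H c r ws L' x1 s1 x2 s2 s"
      by auto
    have "switches_and_exchange {(x1, s1), (x2, s2)} G H"
      using H(1) unfolding switches_and_exchange_def by auto
    moreover have "equal_up_to_vertex_names H F"
      using H(2) KF by (rule path_K4_equal_up_to_vertex_names)
    moreover have "graph_isomorphic G F"
      using path_K4_graph_isomorphic[OF KG KF] mset by (metis size_mset)
    ultimately show ?thesis
      using twoG path_K4_two_connected[OF KF] by blast
  qed
qed

end
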